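(* Let $d\ge1$, let $\gamma$ be a measure on $(\mathbb{R}^d,\mathcal{B}(\mathbb{R}^d))$ with $\gamma(\mathbb{R}^d)<1$ (offspring intensity), and let $\xi$ be the descendant cluster with offspring intensity $\gamma$. Let $f:\mathbb{R}^d\to\mathbb{R}$ be measurable with $\mathbb{E}\big[\big(|f(z)|+\sum_{x\in\xi}|f(z+x)|\big)^n\big]<\infty$ for all $z\in\mathbb{R}^d$ and $n\ge1$. For $z\in\mathbb{R}^d$ and $n\ge1$ let $\kappa_z^{(n)}(f)$ be the $n$-th cumulant of the sum of $f$ over the cluster started from a single point at $z$, i.e. of $f(z)+\sum_{x\in\xi}f(z+x)$. Then, for all $z\in\mathbb{R}^d$, $$\kappa_z^{(1)}(f)=\big((I_d-\Gamma)^{-1}f\big)(z),$$ and for all $n\ge2$, $$\kappa_z^{(n)}(f)=\big((I_d-\Gamma)^{-1}\Gamma h_n\big)(z)=\sum_{k=2}^n\big((I_d-\Gamma)^{-1}\Gamma h_{n,k}\big)(z),$$ where, for $y\in\mathbb{R}^d$, $$h_n(y)=B_n\big(\kappa_y^{(1)}(f),\ldots,\kappa_y^{(n)}(f)\big)-\kappa_y^{(n)}(f),\qquad h_{n,k}(y)=B_{n,k}\big(\kappa_y^{(1)}(f),\ldots,\kappa_y^{(n-k+1)}(f)\big).$$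
   Context: Cluster: start from an ancestor at $0\in\mathbb{R}^d$. Each point $y$ of each generation independently produces offspring located at $y+u$, where $u$ ranges over the points of a Poisson point process on $\mathbb{R}^d$ with intensity measure $\gamma$. The random point configuration $\xi$ (identified with a point measure, points counted with multiplicity) consists of all descendants, of all generations $\ge1$, of the ancestor at $0$; the ancestor itself is not included. Since $\gamma(\mathbb{R}^d)<1$, $\xi$ is almost surely finite. The cluster started from a single point at $z$ consists of $z$ together with the points $z+x$, $x\in\xi$. Cumulants: the cumulants $(\kappa_Y^{(n)})_{n\ge1}$ of a random variable $Y$ with moments of all orders are the coefficients in $\log\mathbb{E}[e^{tY}]=\sum_{n\ge1}\kappa_Y^{(n)}t^n/n!$ (as formal power series in $t$, with $\mathbb{E}[e^{tY}]=1+\sum_{n\ge1}\mathbb{E}[Y^n]t^n/n!$); equivalently $\kappa_Y^{(n)}=\sum_{k=1}^n(k-1)!(-1)^{k-1}\sum_{\pi_1\cup\cdots\cup\pi_k=\{1,\ldots,n\}}\mathbb{E}[Y^{|\pi_1|}]\cdots\mathbb{E}[Y^{|\pi_k|}]$, the inner sum being over partitions of $\{1,\ldots,n\}$ into $k$ blocks. Operators: $\Gamma g(z)=\int_{\mathbb{R}^d}g(z+y)\,\gamma(dy)$, and $(I_d-\Gamma)^{-1}$ denotes the operator $$(I_d-\Gamma)^{-1}g(z)=g(z)+\sum_{m=1}^\infty\int_{\mathbb{R}^d}\cdots\int_{\mathbb{R}^d}g(z+x_1+\cdots+x_m)\,\gamma(dx_1)\cdots\gamma(dx_m),$$ so that $(I_d-\Gamma)^{-1}\Gamma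 g(z)=\sum_{m=1}^\infty\int_{\mathbb{R}^d}\cdots\int_{\mathbb{R}^d}g(z+x_1+\cdots+x_m)\,\gamma(dx_1)\cdots\gamma(dx_m)$. Bell polynomials: for $1\le k\le n$, $$B_{n,k}(a_1,\ldots,a_{n-k+1})=\frac{n!}{k!}\sum_{\substack{l_1+\cdots+l_k=n\\ l_1\ge1,\ldots,l_k\ge1}}\frac{a_{l_1}}{l_1!}\cdots\frac{a_{l_k}}{l_k!},\qquad B_n(a_1,\ldots,a_n)=\sum_{k=1}^nB_{n,k}(a_1,\ldots,a_{n-k+1}).$$ *)

theory Defs
  imports
    "HOL-Probability.Probability"
    "HOL-Computational_Algebra.Formal_Power_Series"
begin

text \<open>
  A random point configuration is a multiset-valued function on a probability space. The intensity
  measures considered here are finite, so the configurations are finite multisets and Borel sets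
  always have real-valued intensity. The count probabilities are written out because the library's
  \<open>poisson_pmf\<close> excludes rate \<open>0\<close>.
\<close>

definition point_count :: "'a set \<Rightarrow> 'a multiset \<Rightarrow> nat" where
  "point_count A N = size {# x \<in># N. x \<in> A #}"

definition poisson_point_process ::
    "'w measure \<Rightarrow> 'a measure \<Rightarrow> ('w \<Rightarrow> 'a multiset) \<Rightarrow> bool" where
  "poisson_point_process M \<gamma> N \<longleftrightarrow>
     (\<forall>A \<in> sets \<gamma>.
        (\<lambda>\<omega>. point_count A (N \<omega>)) \<in> measurable M (count_space UNIV) \<and>
        (\<forall>k. measure M {\<omega> \<in> space M. point_count A (N \<omega>) = k} =
               exp (- measure \<gamma> A) * measure \<gamma> A ^ k / fact k)) \<and>
     (\<forall>(A :: nat \<Rightarrow> 'a set) k. A ` {..<k} \<subseteq> sets \<gamma> \<longrightarrow> disjoint_family_on A {..<k} \<longrightarrow>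
        prob_space.indep_vars M (\<lambda>_. count_space UNIV)
          (\<lambda>i \<omega>. point_count (A i) (N \<omega>)) {..<k})"

text \<open>
  To let every individual reproduce independently, individuals carry Ulam--Harris labels: \<open>[]\<close> is the
  ancestor and \<open>u @ [i]\<close> is the \<open>i\<close>-th child of \<open>u\<close>. The list \<open>off u \<omega>\<close> enumerates the displacements
  from \<open>u\<close> to its children; its order carries no meaning. The enumerations are given for all labels,
  including those of individuals that never come into existence.
\<close>

definition list_borel :: "'a::topological_space list measure" where
  "list_borel = sigma UNIV {{xs. i < length xs \<and> xs ! i \<in> A} | i A. A \<in> sets borel}"

definition poisson_offspring ::
    "'w measure \<Rightarrow> 'a::topological_space measure \<Rightarrow> (nat list \<Rightarrow> 'w \<Rightarrow> 'a list) \<Rightarrow> bool" where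
  "poisson_offspring M \<gamma> off \<longleftrightarrow>
     prob_space.indep_vars M (\<lambda>_. list_borel) off UNIV \<and>
     (\<forall>u. poisson_point_process M \<gamma> (\<lambda>\<omega>. mset (off u \<omega>)))"

definition family_tree :: "(nat list \<Rightarrow> 'w \<Rightarrow> 'a list) \<Rightarrow> 'w \<Rightarrow> nat list set" where
  "family_tree off \<omega> = {u. \<forall>j < length u. u ! j < length (off (take j u) \<omega>)}"

definition position ::
    "(nat list \<Rightarrow> 'w \<Rightarrow> 'a::comm_monoid_add list) \<Rightarrow> 'w \<Rightarrow> nat list \<Rightarrow> 'a" where
  "position off \<omega> u = (\<Sum>j < length u. off (take j u) \<omega> ! (u ! j))"

text \<open>
  If the total offspring mass is less than \<open>1\<close> the family tree is almost surely finite; on the null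
  event where it is infinite, \<open>mset_set\<close> returns the empty multiset.
\<close>

definition descendants ::
    "(nat list \<Rightarrow> 'w \<Rightarrow> 'a::comm_monoid_add list) \<Rightarrow> 'w \<Rightarrow> 'a multiset" where
  "descendants off \<omega> =
     image_mset (position off \<omega>) (mset_set (family_tree off \<omega> - {[]}))"

definition descendant_cluster ::
    "'w measure \<Rightarrow> 'a::real_normed_vector measure \<Rightarrow> ('w \<Rightarrow> 'a multiset) \<Rightarrow> bool" where
  "descendant_cluster M \<gamma> \<xi> \<longleftrightarrow>
     (\<exists>off. poisson_offspring M \<gamma> off \<and> (\<forall>\<omega> \<in> space M. \<xi> \<omega> = descendants off \<omega>))"

definition cluster_sum ::
    "('w \<Rightarrow> 'a::plus multiset) \<Rightarrow> ('a \<Rightarrow> real) \<Rightarrow> 'a \<Rightarrow> 'w \<Rightarrow> real" where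
  "cluster_sum \<xi> f z \<omega> = f z + (\<Sum>x \<in># \<xi> \<omega>. f (z + x))"

text \<open>The series \<open>fps_ln 1\<close> is the expansion of \<open>log (1 + X)\<close>.\<close>

definition cumulant :: "'w measure \<Rightarrow> ('w \<Rightarrow> real) \<Rightarrow> nat \<Rightarrow> real" where
  "cumulant M Y n =
     fact n * fps_nth
       (fps_ln 1 oo Abs_fps (\<lambda>k. if k = 0 then 0 else (LINT \<omega>|M. Y \<omega> ^ k) / fact k)) n"

definition offspring_op ::
    "'a::real_normed_vector measure \<Rightarrow> ('a \<Rightarrow> real) \<Rightarrow> 'a \<Rightarrow> real" where
  "offspring_op \<gamma> g z = (LINT y|\<gamma>. g (z + y))"

text \<open>
  The \<open>m\<close>-th iterate \<open>(offspring_op \<gamma> ^^ m) g z\<close> is the \<open>m\<close>-fold iterated integral of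
  \<open>g (z + x\<^sub>1 + \<dots> + x\<^sub>m)\<close>. As Bochner integrals and \<open>suminf\<close> are total,
  \<open>resolvent_exists\<close> records that all these integrals and the series make sense.
\<close>

definition resolvent ::
    "'a::real_normed_vector measure \<Rightarrow> ('a \<Rightarrow> real) \<Rightarrow> 'a \<Rightarrow> real" where
  "resolvent \<gamma> g z = g z + (\<Sum>m. (offspring_op \<gamma> ^^ Suc m) g z)"

definition resolvent_exists ::
    "'a::real_normed_vector measure \<Rightarrow> ('a \<Rightarrow> real) \<Rightarrow> bool" where
  "resolvent_exists \<gamma> g \<longleftrightarrow>
     (\<forall>z. (\<forall>m. integrable \<gamma> (\<lambda>y. (offspring_op \<gamma> ^^ m) g (z + y))) \<and>
          summable (\<lambda>m. (offspring_op \<gamma> ^^ Suc m) g z))"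

definition partial_bell :: "nat \<Rightarrow> nat \<Rightarrow> (nat \<Rightarrow> real) \<Rightarrow> real" where
  "partial_bell n k a = fact n / fact k *
     (\<Sum>l \<in> {l. length l = k \<and> (\<forall>i \<in> set l. 1 \<le> i) \<and> sum_list l = n}.
        \<Prod>i\<leftarrow>l. a i / fact i)"

definition complete_bell :: "nat \<Rightarrow> (nat \<Rightarrow> real) \<Rightarrow> real" where
  "complete_bell n a = (\<Sum>k = 1..n. partial_bell n k a)"

end

theory Submission
  imports Defs
begin

text \<open>
  Write \<open>S\<^sub>z\<close> for the sum of \<open>f\<close> over the cluster started at \<open>z\<close>. Given the children of the root, the
  subtree sums are independent and distributed like \<open>S\<close> at the children's positions, so the Poisson
  generating functional gives for the characteristic function \<open>\<psi>\<^sub>z(t)\<close> the equation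
  \<open>\<psi>\<^sub>z(t) = exp (\<i> t f(z) + \<integral> (\<psi>\<^bsub>z+y\<^esub>(t) - 1) \<gamma>(dy))\<close>.
  Its Taylor coefficients at \<open>t = 0\<close> say that \<open>\<kappa>\<^sub>z\<^sup>n = \<Gamma> m\<^sub>n (z)\<close>, plus \<open>f(z)\<close> if \<open>n = 1\<close>, where
  \<open>m\<^sub>n(z)\<close> is the \<open>n\<close>-th moment of \<open>S\<^sub>z\<close>. As \<open>m\<^sub>n\<close> is the complete Bell polynomial of the cumulants,
  \<open>h\<^sub>n = m\<^sub>n - \<Gamma> m\<^sub>n\<close> for \<open>n \<ge> 2\<close>, likewise \<open>f = m\<^sub>1 - \<Gamma> m\<^sub>1\<close>, and the resolvent series telescopes to \<open>\<Gamma> m\<^sub>n - lim \<Gamma>\<^sup>j m\<^sub>n\<close>. The limit vanishes: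
  \<open>\<Gamma>\<^sup>j\<close> of the \<open>n\<close>-th absolute moment is the mean of the sum, over generation \<open>j\<close>, of the \<open>n\<close>-th powers
  of the subtree sums of \<open>\<bar>f\<bar>\<close>; this is dominated by the \<open>n\<close>-th power of the whole sum and is \<open>0\<close>
  for \<open>j\<close> beyond the almost surely finite height. The series for the single \<open>h\<^bsub>n,k\<^esub>\<close> converge by
  comparison with \<open>h\<^sub>n\<close> for \<open>\<bar>f\<bar>\<close>.
\<close>

subsection \<open>Formal power series and Bell polynomials\<close>

text \<open>The coefficient of the \<open>k\<close>-th power runs over all compositions of
  \<open>n\<close> into \<open>k\<close> parts, zero parts included; those with a zero part vanish
  because the series has no constant term. The condition \<open>1 \<le> k\<close> gives the index
  range \<open>{0..k - 1}\<close> its intended meaning.\<close>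

lemma partial_bell_eq_fps_power:
  assumes "1 \<le> k"
  shows "partial_bell n k a =
    fact n / fact k * fps_nth (Abs_fps (\<lambda>j. if j = 0 then 0 else a j / fact j) ^ k) n"
proof -
  define A where "A = Abs_fps (\<lambda>j. if j = 0 then 0 else a j / fact j)"
  have "fps_nth (A ^ k) n = (\<Sum>v\<in>natpermute n k. \<Prod>j = 0..k - 1. fps_nth A (v ! j))"
    using assms by (simp add: fps_power_nth)
  also have "\<dots> = (\<Sum>v\<in>natpermute n k. \<Prod>i\<leftarrow>v. fps_nth A i)"
  proof (rule sum.cong[OF refl])
    fix v assume "v \<in> natpermute n k"
    then have "length v = k" by (simp add: natpermute_def)
    moreover have "{0..k - 1} = {0..<k}" using assms by auto
    ultimately show "(\<Prod>j = 0..k - 1. fps_nth A (v ! j)) = (\<Prod>i\<leftarrow>v. fps_nth A i)"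
      by (simp add: prod.list_conv_set_nth)
  qed
  also have "\<dots> = (\<Sum>v\<in>{l. length l = k \<and> (\<forall>i \<in> set l. 1 \<le> i) \<and> sum_list l = n}. \<Prod>i\<leftarrow>v. fps_nth A i)"
  proof (rule sum.mono_neutral_right)
    show "finite (natpermute n k)" by (rule natpermute_finite)
    show "{l. length l = k \<and> (\<forall>i\<in>set l. 1 \<le> i) \<and> sum_list l = n} \<subseteq> natpermute n k"
      by (auto simp: natpermute_def)
    show "\<forall>v\<in>natpermute n k - {l. length l = k \<and> (\<forall>i\<in>set l. 1 \<le> i) \<and> sum_list l = n}.
        (\<Prod>i\<leftarrow>v. fps_nth A i) = 0"
    proof
      fix v assume "v \<in> natpermute n k - {l. length l = k \<and> (\<forall>i\<in>set l. 1 \<le> i) \<and> sum_list l = n}"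
      then have "0 \<in> set v" by (auto simp: natpermute_def not_le less_Suc_eq_le)
      then show "(\<Prod>i\<leftarrow>v. fps_nth A i) = 0"
        unfolding prod_list_zero_iff by (auto simp: A_def intro!: image_eqI[where x = 0])
    qed
  qed
  also have "\<dots> = (\<Sum>v\<in>{l. length l = k \<and> (\<forall>i \<in> set l. 1 \<le> i) \<and> sum_list l = n}. \<Prod>i\<leftarrow>v. a i / fact i)"
    by (intro sum.cong refl arg_cong[where f = prod_list] map_cong) (auto simp: A_def)
  finally show ?thesis
    by (simp add: partial_bell_def A_def)
qed

text \<open>The exponential series has a term \<open>k = 0\<close> that is absent from
  \<open>complete_bell\<close>; it lives in degree 0 only, hence \<open>1 \<le> n\<close>.\<close>

lemma complete_bell_eq_fps:
  assumes "1 \<le> n"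
  shows "complete_bell n a =
    fact n * fps_nth (fps_exp 1 oo Abs_fps (\<lambda>j. if j = 0 then 0 else a j / fact j)) n"
proof -
  define A where "A = Abs_fps (\<lambda>j. if j = 0 then 0 else a j / fact j)"
  have "fps_nth (fps_exp 1 oo A) n = (\<Sum>k = 0..n. 1 / fact k * fps_nth (A ^ k) n)"
    by (simp add: fps_compose_nth)
  also have "\<dots> = (\<Sum>k = 1..n. 1 / fact k * fps_nth (A ^ k) n)"
    using assms by (simp add: sum.atLeast_Suc_atMost)
  finally show ?thesis
    by (simp add: complete_bell_def partial_bell_eq_fps_power A_def[symmetric] sum_distrib_left)
qed

lemma partial_bell_one:
  assumes "1 \<le> n" shows "partial_bell n (Suc 0) a = a n"
  using assms by (simp add: partial_bell_eq_fps_power)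

text \<open>Comparing coefficients, \<open>of_nat (Suc m)\<close> times the coefficient of index
  \<open>Suc m\<close> is determined by the coefficients up to \<open>m\<close>, and this factor is
  nonzero.\<close>

lemma fps_linear_ode_unique:
  fixes P Q :: "real fps"
  assumes "fps_deriv P = D * P" "fps_deriv Q = D * Q" "fps_nth P 0 = fps_nth Q 0"
  shows "P = Q"
proof -
  have "fps_nth P n = fps_nth Q n" for n
  proof (induction n rule: less_induct)
    case (less n)
    show ?case
    proof (cases n)
      case (Suc m)
      have "of_nat (Suc m) * fps_nth P (Suc m) = fps_nth (fps_deriv P) m" by simp
      also have "\<dots> = (\<Sum>i=0..m. fps_nth D i * fps_nth P (m - i))"
        by (simp only: assms fps_mult_nth)
      also have "\<dots> = (\<Sum>i=0..m. fps_nth D i * fps_nth Q (m - i))"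
        by (intro sum.cong refl arg_cong2[where f = times] less) (auto simp: Suc)
      also have "\<dots> = fps_nth (fps_deriv Q) m"
        by (simp only: assms fps_mult_nth)
      also have "\<dots> = of_nat (Suc m) * fps_nth Q (Suc m)" by simp
      finally show ?thesis using Suc by (simp del: of_nat_Suc)
    qed (use assms in auto)
  qed
  then show ?thesis by (simp add: fps_eq_iff)
qed

text \<open>One differential identity gives both directions of the moment-cumulant relation: the
  exponential form generates Bell polynomials, the logarithmic form is the one in the definition of
  \<open>cumulant\<close>.\<close>

lemma fps_exp_log_of_ode:
  fixes P A :: "real fps"
  assumes "fps_deriv P = fps_deriv A * P" "fps_nth P 0 = 1" "fps_nth A 0 = 0"
  shows "P = fps_exp 1 oo A" and "fps_ln 1 oo (P - 1) = A"
proof -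
  show *: "P = fps_exp 1 oo A"
    by (rule fps_linear_ode_unique[OF assms(1)])
      (use assms in \<open>simp_all add: fps_compose_deriv mult.commute\<close>)
  have ln: "fps_ln 1 oo (fps_exp 1 - 1) = (fps_X :: real fps)"
    by (simp add: fps_ln_fps_exp_inv fps_inv)
  have "fps_ln 1 oo (P - 1) = fps_ln 1 oo ((fps_exp 1 - 1) oo A)"
    by (simp add: * fps_compose_sub_distrib)
  also have "\<dots> = (fps_ln 1 oo (fps_exp 1 - 1)) oo A"
    by (rule fps_compose_assoc) (use assms in auto)
  finally show "fps_ln 1 oo (P - 1) = A"
    using assms by (simp add: ln)
qed

text \<open>
  A family in which each member is, up to a factor, the derivative of its predecessor is a Taylor
  expansion at a moving base point; here \<open>p\<close> and \<open>q\<close> expand \<open>\<psi>\<close> and \<open>log \<psi>\<close>.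
\<close>

lemma taylor_family_ode:
  fixes p q :: "nat \<Rightarrow> real \<Rightarrow> 'b::real_normed_field"
  assumes p: "\<And>n t. ((p n) has_vector_derivative of_nat (Suc n) * p (Suc n) t) (at t)"
    and q: "\<And>n t. ((q n) has_vector_derivative of_nat (Suc n) * q (Suc n) t) (at t)"
    and base: "\<And>t. p 1 t = q 1 t * p 0 t"
  shows "fps_deriv (Abs_fps (\<lambda>n. p n t)) = fps_deriv (Abs_fps (\<lambda>n. q n t)) * Abs_fps (\<lambda>n. p n t)"
proof -
  define P where "P t = Abs_fps (\<lambda>n. p n t)" for t
  define Q where "Q t = Abs_fps (\<lambda>n. q n t)" for t
  have "fps_nth (fps_deriv (P t)) n = fps_nth (fps_deriv (Q t) * P t) n" for n t
  proof (induction n arbitrary: t)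
    case 0
    then show ?case using base[of t] by (simp add: P_def Q_def)
  next
    case (Suc n)
    \<comment> \<open>Differentiation in \<open>t\<close> acts on the coefficients as
      \<open>fps_deriv\<close> does. The induction hypothesis holds at every \<open>t\<close>, so
      both of its sides can be differentiated, which gives the next coefficient up to the factor
      \<open>of_nat (Suc n)\<close>.\<close>
    have dP: "((\<lambda>t. fps_nth (P t) j) has_vector_derivative fps_nth (fps_deriv (P t)) j) (at t)" for j t
      using p[of j t] by (simp add: P_def)
    have dQ: "((\<lambda>t. fps_nth (fps_deriv (Q t)) j) has_vector_derivative
        fps_nth (fps_deriv (fps_deriv (Q t))) j) (at t)" for j t
      using has_vector_derivative_mult_right[OF q[of "Suc j" t], of "of_nat (Suc j)"]
      by (simp add: Q_def)
    have "((\<lambda>t. \<Sum>i=0..n. fps_nth (fps_deriv (Q t)) i * fps_nth (P t) (n - i)) has_vector_derivative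
        (\<Sum>i=0..n. fps_nth (fps_deriv (Q t)) i * fps_nth (fps_deriv (P t)) (n - i) +
          fps_nth (fps_deriv (fps_deriv (Q t))) i * fps_nth (P t) (n - i))) (at t)"
      by (intro has_vector_derivative_sum has_vector_derivative_mult dP dQ)
    then have 1: "((\<lambda>t. fps_nth (fps_deriv (Q t) * P t) n) has_vector_derivative
        fps_nth (fps_deriv (fps_deriv (Q t) * P t)) n) (at t)"
      by (simp only: fps_mult_nth[symmetric] fps_deriv_mult fps_add_nth sum.distrib)
    have "((\<lambda>t. of_nat (Suc n) * fps_nth (P t) (Suc n)) has_vector_derivative
        of_nat (Suc n) * fps_nth (fps_deriv (P t)) (Suc n)) (at t)"
      by (intro has_vector_derivative_mult_right dP)
    moreover have "(\<lambda>t. of_nat (Suc n) * fps_nth (P t) (Suc n)) = (\<lambda>t. fps_nth (fps_deriv (Q t) * P t) n)"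
      using Suc.IH by (simp add: fun_eq_iff)
    ultimately have "of_nat (Suc n) * fps_nth (fps_deriv (P t)) (Suc n) =
        fps_nth (fps_deriv (fps_deriv (Q t) * P t)) n"
      using 1 vector_derivative_unique_at by metis
    then have "of_nat (Suc n) * fps_nth (fps_deriv (P t)) (Suc n) =
        of_nat (Suc n) * fps_nth (fps_deriv (Q t) * P t) (Suc n)"
      by (simp only: fps_deriv_nth[of "fps_deriv (Q t) * P t" n] Suc_eq_plus1)
    then show ?case
      by (metis mult_left_cancel of_nat_neq_0)
  qed
  then show ?thesis by (simp only: P_def Q_def fps_eq_iff) simp
qed

section \<open>Positivity, domination and measurability of Bell polynomials\<close>

lemma partial_bell_nonneg:
  assumes "\<And>i. 1 \<le> i \<Longrightarrow> 0 \<le> a i"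
  shows "0 \<le> partial_bell n k a"
proof -
  have "0 \<le> (\<Prod>i\<leftarrow>l. a i / fact i)" if "\<forall>i\<in>set l. 1 \<le> i" for l
    using that assms by (induction l) auto
  then show ?thesis
    unfolding partial_bell_def by (intro mult_nonneg_nonneg sum_nonneg) auto
qed

text \<open>Bell polynomials have nonnegative coefficients, so the triangle inequality applies
  monomial by monomial. This later compares the cumulants for \<open>f\<close> with those for its
  absolute value.\<close>

lemma abs_partial_bell_le:
  assumes "\<And>i. 1 \<le> i \<Longrightarrow> \<bar>a i\<bar> \<le> b i"
  shows "\<bar>partial_bell n k a\<bar> \<le> partial_bell n k b"
proof -
  have "\<bar>\<Prod>i\<leftarrow>l. a i / fact i\<bar> \<le> (\<Prod>i\<leftarrow>l. b i / fact i)" if "\<forall>i\<in>set l. 1 \<le> i" for l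
    using that
  proof (induction l)
    case (Cons i l)
    then have "\<bar>a i / fact i\<bar> \<le> b i / fact i"
      using assms[of i] by (simp add: divide_right_mono)
    with Cons show ?case
      by (auto simp: abs_mult simp del: times_divide_eq_left abs_divide intro!: mult_mono intro: order_trans[OF abs_ge_zero])
  qed simp
  then have "\<bar>\<Sum>l | length l = k \<and> (\<forall>i\<in>set l. 1 \<le> i) \<and> sum_list l = n. \<Prod>i\<leftarrow>l. a i / fact i\<bar>
      \<le> (\<Sum>l | length l = k \<and> (\<forall>i\<in>set l. 1 \<le> i) \<and> sum_list l = n. \<Prod>i\<leftarrow>l. b i / fact i)"
    by (intro order_trans[OF sum_abs] sum_mono) simp
  then have "fact n / fact k * \<bar>\<Sum>l | length l = k \<and> (\<forall>i\<in>set l. 1 \<le> i) \<and> sum_list l = n. \<Prod>i\<leftarrow>l. a i / fact i\<bar>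
      \<le> fact n / fact k * (\<Sum>l | length l = k \<and> (\<forall>i\<in>set l. 1 \<le> i) \<and> sum_list l = n. \<Prod>i\<leftarrow>l. b i / fact i)"
    by (rule mult_left_mono) simp
  then show ?thesis
    by (simp add: partial_bell_def abs_mult)
qed

lemma borel_measurable_partial_bell:
  assumes "\<And>i. 1 \<le> i \<Longrightarrow> (\<lambda>z. a z i) \<in> borel_measurable N"
  shows "(\<lambda>z. partial_bell n k (a z)) \<in> borel_measurable N"
proof -
  have "(\<lambda>z. \<Prod>i\<leftarrow>l. a z i / fact i) \<in> borel_measurable N" if "\<forall>i\<in>set l. 1 \<le> i" for l
    using that
  proof (induction l)
    case (Cons i l)
    then show ?case using assms[of i] by simp
  qed simp
  then show ?thesis
    unfolding partial_bell_def by (intro borel_measurable_times borel_measurable_sum) auto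
qed

lemma complete_bell_minus:
  assumes "2 \<le> n"
  shows "complete_bell n a - a n = (\<Sum>k = 2..n. partial_bell n k a)"
proof -
  have "complete_bell n a = partial_bell n 1 a + (\<Sum>k = 2..n. partial_bell n k a)"
    unfolding complete_bell_def using assms
    by (subst sum.atLeast_Suc_atMost) (auto simp: numeral_2_eq_2)
  then show ?thesis
    using assms by (simp add: partial_bell_one)
qed

subsection \<open>Sums over trees\<close>

text \<open>Evaluation is the canonical offspring family on configurations, the configuration itself
  being the sample point. This separates deterministic facts about trees from the probability
  space.\<close>

abbreviation tree :: "(nat list \<Rightarrow> 'a list) \<Rightarrow> nat list set" where
  "tree c \<equiv> family_tree (\<lambda>u c. c u) c"

abbreviation pos :: "(nat list \<Rightarrow> 'a::comm_monoid_add list) \<Rightarrow> nat list \<Rightarrow> 'a" where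
  "pos c \<equiv> position (\<lambda>u c. c u) c"

text \<open>The configuration as seen from child \<open>i\<close> of the root: the head of a label
  is the first step away from the root.\<close>

definition subconf :: "nat \<Rightarrow> (nat list \<Rightarrow> 'a) \<Rightarrow> nat list \<Rightarrow> 'a" where
  "subconf i c = (\<lambda>u. c (i # u))"

lemma Nil_in_tree [simp]: "[] \<in> tree c"
  by (simp add: family_tree_def)

lemma Cons_in_tree_iff: "i # u \<in> tree c \<longleftrightarrow> i < length (c []) \<and> u \<in> tree (subconf i c)"
  by (auto simp: family_tree_def subconf_def All_less_Suc2)

lemma pos_Nil [simp]: "pos c [] = 0"
  by (simp add: position_def)

lemma pos_Cons: "pos c (i # u) = c [] ! i + pos (subconf i c) u"
  unfolding position_def subconf_def
  by (simp add: sum.lessThan_Suc_shift del: sum.lessThan_Suc)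

lemma tree_level_0: "{u \<in> tree c. length u \<le> 0} = {[]}"
  by auto

lemma tree_level_Suc:
  "{u \<in> tree c. length u \<le> Suc N} =
    insert [] (\<Union>i<length (c []). Cons i ` {u \<in> tree (subconf i c). length u \<le> N})"
  (is "?L = ?R")
proof (rule set_eqI)
  fix u show "u \<in> ?L \<longleftrightarrow> u \<in> ?R"
    by (cases u) (auto simp: Cons_in_tree_iff)
qed

lemma finite_tree_level: "finite {u \<in> tree c. length u \<le> N}"
  by (induction N arbitrary: c) (simp_all add: tree_level_0 tree_level_Suc del: le_zero_eq)

text \<open>The sum over the first \<open>N\<close> generations. It is meaningful for every
  configuration, even when the tree is infinite, because each individual has finitely many
  children.\<close>

fun truncated_sum ::
  "('a::comm_monoid_add \<Rightarrow> real) \<Rightarrow> nat \<Rightarrow> (nat list \<Rightarrow> 'a list) \<Rightarrow> 'a \<Rightarrow> real" where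
  "truncated_sum f 0 c z = f z"
| "truncated_sum f (Suc N) c z =
    f z + (\<Sum>i<length (c []). truncated_sum f N (subconf i c) (z + c [] ! i))"

lemma truncated_sum_eq:
  "truncated_sum f N c z = (\<Sum>u | u \<in> tree c \<and> length u \<le> N. f (z + pos c u))"
proof (induction N arbitrary: c z)
  case 0
  then show ?case by (simp add: tree_level_0 del: le_zero_eq)
next
  case (Suc N)
  have "(\<Sum>u | u \<in> tree c \<and> length u \<le> Suc N. f (z + pos c u)) =
      f z + (\<Sum>u\<in>(\<Union>i<length (c []). Cons i ` {u \<in> tree (subconf i c). length u \<le> N}). f (z + pos c u))"
    unfolding tree_level_Suc
    by (subst sum.insert) (auto simp: finite_tree_level)
  also have "(\<Sum>u\<in>(\<Union>i<length (c []). Cons i ` {u \<in> tree (subconf i c). length u \<le> N}). f (z + pos c u)) =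
      (\<Sum>i<length (c []). \<Sum>u\<in>Cons i ` {u \<in> tree (subconf i c). length u \<le> N}. f (z + pos c u))"
    by (rule sum.UNION_disjoint) (auto simp: finite_tree_level)
  also have "\<dots> = (\<Sum>i<length (c []). truncated_sum f N (subconf i c) (z + c [] ! i))"
    by (simp add: Suc sum.reindex pos_Cons add.assoc)
  finally show ?case by simp
qed

lemma truncated_sum_eventually:
  assumes "finite (tree c)"
  shows "\<forall>\<^sub>F N in sequentially. truncated_sum f N c z = (\<Sum>u\<in>tree c. f (z + pos c u))"
proof -
  obtain N0 where N0: "\<forall>u\<in>tree c. length u < N0"
    using finite_nat_set_iff_bounded[of "length ` tree c"] assms by auto
  have "{u. u \<in> tree c \<and> length u \<le> N} = tree c" if "N0 \<le> N" for N
    using N0 that by fastforce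
  then show ?thesis
    by (intro eventually_sequentiallyI[of N0]) (simp add: truncated_sum_eq)
qed

text \<open>As a limit of truncations this is measurable on the whole configuration space for
  measurable \<open>f\<close>; where the tree is finite it is the sum over the tree.\<close>

definition total_sum ::
  "('a::comm_monoid_add \<Rightarrow> real) \<Rightarrow> (nat list \<Rightarrow> 'a list) \<Rightarrow> 'a \<Rightarrow> real" where
  "total_sum f c z = lim (\<lambda>N. truncated_sum f N c z)"

lemma truncated_sum_tendsto:
  assumes "finite (tree c)"
  shows "(\<lambda>N. truncated_sum f N c z) \<longlonglongrightarrow> (\<Sum>u\<in>tree c. f (z + pos c u))"
  by (rule tendsto_eventually[OF truncated_sum_eventually[OF assms]])

lemma total_sum_eq:
  assumes "finite (tree c)"
  shows "total_sum f c z = (\<Sum>u\<in>tree c. f (z + pos c u))"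
  unfolding total_sum_def by (rule limI[OF truncated_sum_tendsto[OF assms]])

lemma finite_tree_subconf:
  assumes "finite (tree c)" "i < length (c [])"
  shows "finite (tree (subconf i c))"
proof (rule finite_imageD)
  show "finite (Cons i ` tree (subconf i c))"
    by (rule finite_subset[OF _ assms(1)]) (use assms in \<open>auto simp: Cons_in_tree_iff\<close>)
qed auto

text \<open>Limit of the recursion for truncated sums. The subtrees at the children are finite too,
  so every term converges.\<close>

lemma total_sum_rec:
  assumes "finite (tree c)"
  shows "total_sum f c z = f z + (\<Sum>i<length (c []). total_sum f (subconf i c) (z + c [] ! i))"
proof -
  have "(\<lambda>N. truncated_sum f (Suc N) c z) \<longlonglongrightarrow>
      f z + (\<Sum>i<length (c []). total_sum f (subconf i c) (z + c [] ! i))"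
    unfolding truncated_sum.simps
    by (intro tendsto_intros) 
      (auto simp: total_sum_eq finite_tree_subconf[OF assms] intro!: truncated_sum_tendsto finite_tree_subconf[OF assms])
  moreover have "(\<lambda>N. truncated_sum f (Suc N) c z) \<longlonglongrightarrow> total_sum f c z"
    unfolding total_sum_eq[OF assms] by (rule LIMSEQ_Suc[OF truncated_sum_tendsto[OF assms]])
  ultimately show ?thesis by (rule LIMSEQ_unique[rotated])
qed

lemma total_sum_nonneg:
  assumes "finite (tree c)" "\<And>y. 0 \<le> f y"
  shows "0 \<le> total_sum f c z"
  by (simp add: total_sum_eq assms sum_nonneg)

lemma abs_total_sum_le:
  assumes "finite (tree c)"
  shows "\<bar>total_sum f c z\<bar> \<le> total_sum (\<lambda>y. \<bar>f y\<bar>) c z"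
  by (simp add: total_sum_eq assms sum_abs)

text \<open>The separate summand \<open>f z\<close> of \<open>cluster_sum\<close> is the term of the
  label \<open>[]\<close>, whose position is 0. Summing over labels rather than positions accounts
  for multiplicities.\<close>

lemma cluster_sum_descendants:
  assumes "finite (tree (\<lambda>u. off u \<omega>))" and "\<xi> \<omega> = descendants off \<omega>"
  shows "cluster_sum \<xi> f z \<omega> = total_sum f (\<lambda>u. off u \<omega>) z"
proof -
  let ?c = "\<lambda>u. off u \<omega>"
  have 1: "family_tree off \<omega> = tree ?c" "position off \<omega> = pos ?c"
    by (simp_all add: family_tree_def position_def fun_eq_iff)
  have "(\<Sum>x\<in>#\<xi> \<omega>. f (z + x)) = (\<Sum>u\<in>tree ?c - {[]}. f (z + pos ?c u))"
    by (simp add: assms(2) descendants_def 1 multiset.map_comp o_def sum_unfold_sum_mset)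
  then show ?thesis
    using sum.remove[OF assms(1) Nil_in_tree, of "\<lambda>u. f (z + pos ?c u)"]
    by (simp add: cluster_sum_def total_sum_eq[OF assms(1)])
qed

text \<open>Each individual of generation \<open>m\<close> contributes \<open>F\<close> of its own
  subtree and position; with \<open>F\<close> constantly 1 this is the size of the generation.
  Values in \<open>ennreal\<close> avoid integrability questions.\<close>

fun generation_sum ::
  "((nat list \<Rightarrow> 'a list) \<Rightarrow> 'a \<Rightarrow> ennreal) \<Rightarrow> nat \<Rightarrow> (nat list \<Rightarrow> 'a::plus list) \<Rightarrow> 'a \<Rightarrow> ennreal" where
  "generation_sum F 0 c z = F c z"
| "generation_sum F (Suc m) c z =
    (\<Sum>i<length (c []). generation_sum F m (subconf i c) (z + c [] ! i))"

text \<open>An individual at depth at least \<open>m\<close> would have an ancestor, possibly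
  itself, in the empty generation \<open>m\<close>.\<close>

lemma generation_sum_one_eq_0:
  assumes "generation_sum (\<lambda>_ _. 1) m c z = 0" "u \<in> tree c"
  shows "length u < m"
  using assms
proof (induction m arbitrary: c z u)
  case (Suc m)
  then show ?case
    by (cases u) (auto simp: Cons_in_tree_iff sum_eq_0_iff)
qed simp

lemma finite_tree_of_generation_0:
  assumes "generation_sum (\<lambda>_ _. 1) m c z = 0"
  shows "finite (tree c)"
  by (rule finite_subset[OF _ finite_tree_level[of c m]])
    (use generation_sum_one_eq_0[OF assms] in \<open>auto intro: less_imp_le\<close>)

lemma generation_sum_eq_0:
  assumes "\<And>u. u \<in> tree c \<Longrightarrow> length u < m"
  shows "generation_sum F m c z = 0"
  using assms
proof (induction m arbitrary: c z)
  case 0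
  from 0[OF Nil_in_tree] show ?case by simp
next
  case (Suc m)
  have "generation_sum F m (subconf i c) (z + c [] ! i) = 0" if "i < length (c [])" for i
    using Suc.prems[of "i # _"] that by (intro Suc.IH) (auto simp: Cons_in_tree_iff)
  then show ?case by simp
qed

lemma generation_sum_eventually_0:
  assumes "finite (tree c)"
  shows "\<forall>\<^sub>F m in sequentially. generation_sum F m c z = 0"
proof -
  obtain N where N: "\<forall>u\<in>tree c. length u < N"
    using finite_nat_set_iff_bounded[of "length ` tree c"] assms by auto
  then show ?thesis
    by (intro eventually_sequentiallyI[of N] generation_sum_eq_0) auto
qed

text \<open>Keep one factor \<open>a i\<close> and bound the other \<open>k\<close> factors by the
  whole sum. This needs at least one factor.\<close>

lemma sum_power_le_power_sum:
  fixes a :: "'i \<Rightarrow> real"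
  assumes "finite I" "\<And>i. i \<in> I \<Longrightarrow> 0 \<le> a i" "1 \<le> n"
  shows "(\<Sum>i\<in>I. a i ^ n) \<le> (\<Sum>i\<in>I. a i) ^ n"
proof -
  obtain k where n: "n = Suc k" using assms(3) by (cases n) auto
  have "(\<Sum>i\<in>I. a i ^ n) \<le> (\<Sum>i\<in>I. a i * (\<Sum>j\<in>I. a j) ^ k)"
    unfolding n power_Suc using assms
    by (intro sum_mono mult_left_mono power_mono member_le_sum) auto
  also have "\<dots> = (\<Sum>i\<in>I. a i) ^ n" by (simp add: n sum_distrib_right)
  finally show ?thesis .
qed

text \<open>Induction along the root recursion: the powers of the children's subtree sums add up to
  at most the power of their sum, and adding the root's own term \<open>f z\<close>, which is
  nonnegative, only increases it.\<close>

lemma generation_sum_power_le: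
  assumes "finite (tree c)" "\<And>y. 0 \<le> f y" "1 \<le> n"
  shows "generation_sum (\<lambda>c y. ennreal (total_sum f c y ^ n)) m c z \<le> ennreal (total_sum f c z ^ n)"
  using assms(1)
proof (induction m arbitrary: c z)
  case (Suc m)
  note fin = finite_tree_subconf[OF Suc.prems]
  let ?a = "\<lambda>i. total_sum f (subconf i c) (z + c [] ! i)"
  have a: "0 \<le> ?a i" if "i < length (c [])" for i
    using that by (intro total_sum_nonneg fin assms)
  have "generation_sum (\<lambda>c y. ennreal (total_sum f c y ^ n)) (Suc m) c z
      \<le> (\<Sum>i<length (c []). ennreal (?a i ^ n))"
    by (simp, intro sum_mono Suc.IH fin) simp
  also have "\<dots> = ennreal (\<Sum>i<length (c []). ?a i ^ n)"
    using a by (intro sum_ennreal) auto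
  also have "\<dots> \<le> ennreal ((\<Sum>i<length (c []). ?a i) ^ n)"
    using a assms by (intro ennreal_leI sum_power_le_power_sum) auto
  also have "\<dots> \<le> ennreal (total_sum f c z ^ n)"
    unfolding total_sum_rec[OF Suc.prems, of f z] using a assms(2)
    by (intro ennreal_leI power_mono) (auto intro!: sum_nonneg)
  finally show ?case .
qed simp

subsection \<open>Poisson point processes\<close>

lemma point_count_add_mset:
  "point_count A (add_mset y N) = (if y \<in> A then Suc (point_count A N) else point_count A N)"
  by (simp add: point_count_def)

lemma point_count_empty [simp]: "point_count A {#} = 0"
  by (simp add: point_count_def)

lemma point_count_UNIV [simp]: "point_count UNIV N = size N"
  by (simp add: point_count_def)

section \<open>Generating function and mean of Poisson counts\<close>

context prob_space
begin

lemma poisson_distr: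
  assumes "X \<in> measurable M (count_space UNIV)" "0 \<le> r"
    and "\<And>k. measure M {\<omega> \<in> space M. X \<omega> = k} = exp (- r) * r ^ k / fact k"
  shows "distr M (count_space UNIV) X =
    density (count_space UNIV) (\<lambda>k. ennreal (exp (- r) * r ^ k / fact k))"
proof (rule measure_eqI_countable[of _ UNIV])
  fix k :: nat
  have "emeasure (distr M (count_space UNIV) X) {k} = emeasure M {\<omega> \<in> space M. X \<omega> = k}"
    using assms(1) by (subst emeasure_distr) (auto intro!: arg_cong[where f = "emeasure M"])
  also have "\<dots> = ennreal (exp (- r) * r ^ k / fact k)"
    by (simp add: emeasure_eq_measure assms)
  also have "\<dots> = emeasure (density (count_space UNIV) (\<lambda>k. ennreal (exp (- r) * r ^ k / fact k))) {k}"
    by (simp add: emeasure_density)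
  finally show "emeasure (distr M (count_space UNIV) X) {k} =
    emeasure (density (count_space UNIV) (\<lambda>k. ennreal (exp (- r) * r ^ k / fact k))) {k}" .
qed auto

text \<open>The generating function is entire, so any complex \<open>c\<close> is allowed: values of
  modulus at most 2 occur in the approximation below, and \<open>c = 2\<close> itself supplies the
  dominating function there.\<close>

lemma poisson_expectation_power:
  fixes c :: complex
  assumes X: "X \<in> measurable M (count_space UNIV)" "0 \<le> r"
    and p: "\<And>k. measure M {\<omega> \<in> space M. X \<omega> = k} = exp (- r) * r ^ k / fact k"
  shows "integrable M (\<lambda>\<omega>. c ^ X \<omega>)" "(LINT \<omega>|M. c ^ X \<omega>) = exp (of_real r * (c - 1))"
proof -
  let ?D = "density (count_space UNIV) (\<lambda>k. ennreal (exp (- r) * r ^ k / fact k))"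
  note D = poisson_distr[OF assms]
  have e: "(exp (- r) * r ^ k / fact k) *\<^sub>R c ^ k =
      exp (- of_real r) * ((of_real r * c) ^ k /\<^sub>R fact k)" for k
    by (simp add: scaleR_conv_of_real power_mult_distrib exp_of_real[symmetric] field_simps)
  have sums: "(\<lambda>k. (exp (- r) * r ^ k / fact k) *\<^sub>R c ^ k) sums
      (exp (- of_real r) * exp (of_real r * c))"
    unfolding e by (intro sums_mult exp_converges)
  have "norm ((exp (- r) * r ^ k / fact k) *\<^sub>R c ^ k) = 
    exp (- r) * ((r * norm c) ^ k /\<^sub>R fact k)" for k
    using \<open>0 \<le> r\<close> by (simp add: norm_power norm_mult power_mult_distrib field_simps)
  then have int0: "integrable (count_space UNIV) (\<lambda>k. (exp (- r) * r ^ k / fact k) *\<^sub>R c ^ k)"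
    unfolding integrable_count_space_nat_iff
    by (simp only:) (intro summable_mult summable_exp_generic)
  have int: "integrable ?D (\<lambda>k. c ^ k)"
    using int0 \<open>0 \<le> r\<close> by (subst integrable_density) auto
  show "integrable M (\<lambda>\<omega>. c ^ X \<omega>)"
    using int unfolding D[symmetric] by (subst (asm) integrable_distr_eq) (auto simp: X)
  have "(LINT \<omega>|M. c ^ X \<omega>) = (LINT k|?D. c ^ k)"
    unfolding D[symmetric] by (subst integral_distr) (auto simp: X)
  also have "\<dots> = (LINT k|count_space UNIV. (exp (- r) * r ^ k / fact k) *\<^sub>R c ^ k)"
    using \<open>0 \<le> r\<close> by (subst integral_density) auto
  also have "\<dots> = exp (- of_real r) * exp (of_real r * c)"
    using sums_unique[OF sums] integral_count_space_nat[OF int0] by simp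
  also have "\<dots> = exp (of_real r * (c - 1))"
    by (simp add: mult_exp_exp algebra_simps)
  finally show "(LINT \<omega>|M. c ^ X \<omega>) = exp (of_real r * (c - 1))" .
qed

text \<open>The factor \<open>k\<close> kills the term \<open>k = 0\<close> and cancels against the
  factorial, leaving \<open>r\<close> times an exponential series.\<close>

lemma poisson_expectation:
  assumes X: "X \<in> measurable M (count_space UNIV)" "0 \<le> r"
    and p: "\<And>k. measure M {\<omega> \<in> space M. X \<omega> = k} = exp (- r) * r ^ k / fact k"
  shows "(\<integral>\<^sup>+\<omega>. of_nat (X \<omega>) \<partial>M) = ennreal r"
proof -
  let ?D = "density (count_space UNIV) (\<lambda>k. ennreal (exp (- r) * r ^ k / fact k))"
  have "(\<lambda>k. exp (- r) * r * (r ^ k /\<^sub>R fact k)) sums (exp (- r) * r * exp r)"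
    by (intro sums_mult exp_converges)
  moreover have "exp (- r) * r * (r ^ k /\<^sub>R fact k) = exp (- r) * r ^ Suc k / fact (Suc k) * real (Suc k)" for k
    by (simp add: field_simps del: of_nat_Suc)
  ultimately have "(\<lambda>k. exp (- r) * r ^ Suc k / fact (Suc k) * real (Suc k)) sums r"
    by (simp only: exp_minus mult.commute[of "inverse (exp r)"] mult.assoc) simp
  then have s: "(\<lambda>k. exp (- r) * r ^ k / fact k * real k) sums r"
    by (subst (asm) sums_Suc_iff) simp
  have "(\<integral>\<^sup>+\<omega>. of_nat (X \<omega>) \<partial>M) = (\<integral>\<^sup>+k. of_nat k \<partial>?D)"
    unfolding poisson_distr[OF assms, symmetric] by (subst nn_integral_distr) (auto simp: X)
  also have "\<dots> = (\<integral>\<^sup>+k. ennreal (exp (- r) * r ^ k / fact k * real k) \<partial>count_space UNIV)"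
    using \<open>0 \<le> r\<close>
    by (subst nn_integral_density) (auto simp: ennreal_of_nat_eq_real_of_nat ennreal_mult'[symmetric])
  also have "\<dots> = ennreal r"
    using s \<open>0 \<le> r\<close>
    by (subst nn_integral_count_space_nat, subst suminf_ennreal_eq) auto
  finally show ?thesis .
qed

end

text \<open>Grouping the points by the value of \<open>u\<close> replaces a product over a random
  configuration by a fixed finite product of powers of counts.\<close>

lemma prod_mset_eq_prod_point_count:
  fixes u :: "'b \<Rightarrow> 'c::comm_monoid_mult"
  assumes "finite I" "inj_on c I" "range u \<subseteq> c ` I"
  shows "(\<Prod>y\<in>#N. u y) = (\<Prod>i\<in>I. c i ^ point_count (u -` {c i}) N)"
proof (induction N)
  case (add y N)
  obtain j where j: "j \<in> I" "u y = c j" using assms(3) by auto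
  have "(\<Prod>i\<in>I. c i ^ point_count (u -` {c i}) (add_mset y N)) =
      (\<Prod>i\<in>I. (if i = j then c j else 1) * c i ^ point_count (u -` {c i}) N)"
    using j assms(2) by (intro prod.cong) (auto simp: point_count_add_mset inj_on_def)
  also have "\<dots> = u y * (\<Prod>i\<in>I. c i ^ point_count (u -` {c i}) N)"
    using j assms(1) by (simp add: prod.distrib)
  finally show ?case using add by simp
qed simp

context prob_space
begin

lemma poisson_point_process_count:
  assumes "poisson_point_process M \<gamma> N" "A \<in> sets \<gamma>"
  shows "(\<lambda>\<omega>. point_count A (N \<omega>)) \<in> measurable M (count_space UNIV)"
    "measure M {\<omega> \<in> space M. point_count A (N \<omega>) = k} = exp (- measure \<gamma> A) * measure \<gamma> A ^ k / fact k"
  using assms by (auto simp: poisson_point_process_def)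

text \<open>The level sets of \<open>u\<close> are disjoint, so their counts are independent Poisson
  variables; the generating functions multiply and the exponents add up to the integral of
  \<open>u - 1\<close>.\<close>

lemma poisson_generating_functional_simple:
  fixes u :: "'b \<Rightarrow> complex"
  assumes N: "poisson_point_process M \<gamma> N" and "finite_measure \<gamma>" "space \<gamma> = UNIV"
    and u: "simple_function \<gamma> u"
  shows "(\<lambda>\<omega>. \<Prod>y\<in>#N \<omega>. u y) \<in> borel_measurable M"
    and "(LINT \<omega>|M. (\<Prod>y\<in>#N \<omega>. u y)) = exp (LINT y|\<gamma>. (u y - 1))"
proof -
  interpret \<gamma>: finite_measure \<gamma> by fact
  have sets: "u -` {x} \<in> sets \<gamma>" if "x \<in> range u" for x
    using u that assms(3) by (auto simp: simple_function_def)
  have "finite (range u)"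
    using u assms(3) by (auto simp: simple_function_def)
  from ex_bij_betw_nat_finite[OF this] obtain c n where "bij_betw c {0..<n::nat} (range u)" by blast
  then have c: "inj_on c {..<n}" "c ` {..<n} = range u"
    by (auto simp: bij_betw_def atLeast0LessThan)
  define A where "A i = u -` {c i}" for i
  have A: "A i \<in> sets \<gamma>" if "i < n" for i
    using sets[of "c i"] c(2) that by (auto simp: A_def)
  have prod: "(\<Prod>y\<in>#N \<omega>. u y) = (\<Prod>i<n. c i ^ point_count (A i) (N \<omega>))" for \<omega>
    unfolding A_def by (rule prod_mset_eq_prod_point_count) (use c in auto)
  have disj: "disjoint_family_on A {..<n}"
    using c(1) by (auto simp: disjoint_family_on_def A_def inj_on_def)
  have "indep_vars (\<lambda>_. count_space UNIV) (\<lambda>i \<omega>. point_count (A i) (N \<omega>)) {..<n}"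
    using N disj A unfolding poisson_point_process_def by blast
  then have ind: "indep_vars (\<lambda>_. borel) (\<lambda>i \<omega>. c i ^ point_count (A i) (N \<omega>)) {..<n}"
    by (rule indep_vars_compose2[where Y = "\<lambda>i k. c i ^ k"]) simp
  note pp = poisson_point_process_count[OF N A]
  note E = poisson_expectation_power[OF pp(1) measure_nonneg pp(2)]
  have "(LINT \<omega>|M. (\<Prod>i<n. c i ^ point_count (A i) (N \<omega>))) =
      (\<Prod>i<n. LINT \<omega>|M. c i ^ point_count (A i) (N \<omega>))"
    by (rule indep_vars_lebesgue_integral[OF _ ind]) (auto intro: E)
  also have "\<dots> = (\<Prod>i<n. exp (of_real (measure \<gamma> (A i)) * (c i - 1)))"
    by (intro prod.cong refl E) auto
  also have "\<dots> = exp (\<Sum>i<n. of_real (measure \<gamma> (A i)) * (c i - 1))"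
    by (simp add: exp_sum)
  also have "(\<Sum>i<n. of_real (measure \<gamma> (A i)) * (c i - 1)) =
      (\<Sum>i<n. LINT y|\<gamma>. indicator (A i) y *\<^sub>R (c i - 1))"
    using A by (intro sum.cong) (auto simp: scaleR_conv_of_real)
  also have "\<dots> = (LINT y|\<gamma>. (\<Sum>i<n. indicator (A i) y *\<^sub>R (c i - 1)))"
    using A by (intro Bochner_Integration.integral_sum[symmetric]) (auto intro!: integrable_scaleR_left simp: \<gamma>.emeasure_finite less_top[symmetric])
  also have "\<dots> = (LINT y|\<gamma>. (u y - 1))"
  proof (rule Bochner_Integration.integral_cong[OF refl])
    fix y
    have "u y \<in> c ` {..<n}" using c(2) by simp
    then obtain j where j: "j < n" "u y = c j" by auto
    have "(\<Sum>i<n. indicator (A i) y *\<^sub>R (c i - 1)) = (\<Sum>i<n. if i = j then c j - 1 else 0)"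
      using j c(1) by (intro sum.cong) (auto simp: A_def inj_on_def indicator_def)
    then show "(\<Sum>i<n. indicator (A i) y *\<^sub>R (c i - 1)) = u y - 1"
      using j by simp
  qed
  finally show "(LINT \<omega>|M. (\<Prod>y\<in>#N \<omega>. u y)) = exp (LINT y|\<gamma>. (u y - 1))"
    by (simp add: prod)
  show "(\<lambda>\<omega>. \<Prod>y\<in>#N \<omega>. u y) \<in> borel_measurable M"
    unfolding prod using pp(1) by (intro borel_measurable_prod measurable_compose[OF pp(1)]) auto
qed

end

section \<open>Generating functional for bounded functions and Campbell's formula\<close>

lemma tendsto_prod_mset:
  fixes s :: "nat \<Rightarrow> 'b \<Rightarrow> 'c::{topological_semigroup_mult, comm_monoid_mult}"
  assumes "\<And>y. (\<lambda>i. s i y) \<longlonglongrightarrow> u y"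
  shows "(\<lambda>i. \<Prod>y\<in>#N. s i y) \<longlonglongrightarrow> (\<Prod>y\<in>#N. u y)"
  by (induction N) (auto intro!: tendsto_intros assms)

lemma norm_prod_mset_le:
  fixes u :: "'b \<Rightarrow> complex"
  assumes "\<And>y. norm (u y) \<le> C"
  shows "norm (\<Prod>y\<in>#N. u y) \<le> C ^ size N"
proof (induction N)
  case (add y N)
  then show ?case
    using order_trans[OF norm_ge_zero assms] by (auto simp: norm_mult intro!: mult_mono assms)
qed simp

lemma sum_mset_SUP:
  fixes U :: "nat \<Rightarrow> 'b \<Rightarrow> ennreal"
  assumes "incseq U"
  shows "(\<Sum>y\<in>#N. SUP i. U i y) = (SUP i. \<Sum>y\<in>#N. U i y)"
proof (induction N)
  case (add y N)
  have "incseq (\<lambda>i. U i y)"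
    using assms by (auto simp: incseq_def le_fun_def)
  moreover have "incseq (\<lambda>i. \<Sum>y\<in>#N. U i y)"
    using assms by (auto simp: incseq_def le_fun_def intro!: sum_mset_mono)
  ultimately show ?case using add by (simp add: ennreal_SUP_add)
qed simp

context prob_space
begin

text \<open>Approximation by simple functions and dominated convergence on both sides of the
  identity.\<close>

lemma poisson_generating_functional:
  fixes u :: "'b \<Rightarrow> complex"
  assumes N: "poisson_point_process M \<gamma> N" and "finite_measure \<gamma>" "space \<gamma> = UNIV"
    and u: "u \<in> borel_measurable \<gamma>" "\<And>y. norm (u y) \<le> 1"
  shows "(LINT \<omega>|M. (\<Prod>y\<in>#N \<omega>. u y)) = exp (LINT y|\<gamma>. (u y - 1))"
proof -
  interpret \<gamma>: finite_measure \<gamma> by fact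
  from borel_measurable_implies_sequence_metric[OF u(1), of 0] obtain s where
    s: "\<And>i. simple_function \<gamma> (s i)" "\<And>y. (\<lambda>i. s i y) \<longlonglongrightarrow> u y"
    and bound: "\<And>i y. norm (s i y) \<le> 2 * norm (u y)"
    by (simp add: assms(3)) metis
  then have s2: "norm (s i y) \<le> 2" for i y
    using bound[of i y] u(2)[of y] by linarith
  note simple = poisson_generating_functional_simple[OF N assms(2,3) s(1)]
  have "UNIV \<in> sets \<gamma>" using sets.top[of \<gamma>] assms(3) by simp
  note pp = poisson_point_process_count[OF N this]
  \<comment> \<open>The approximants are bounded by 2 rather than by 1, so their products are only
    bounded by \<open>2 ^ size (N \<omega>)\<close>. This is integrable because a Poisson variable
    has all exponential moments.\<close>
  have "integrable M (\<lambda>\<omega>. norm ((2::complex) ^ size (N \<omega>)))"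
    using poisson_expectation_power(1)[OF pp(1) measure_nonneg pp(2), of 2] by auto
  then have int: "integrable M (\<lambda>\<omega>. 2 ^ size (N \<omega>) :: real)"
    by (simp add: norm_power)
  have lim: "(\<lambda>i. \<Prod>y\<in>#N \<omega>. s i y) \<longlonglongrightarrow> (\<Prod>y\<in>#N \<omega>. u y)" for \<omega>
    by (rule tendsto_prod_mset[OF s(2)])
  have meas: "(\<lambda>\<omega>. \<Prod>y\<in>#N \<omega>. u y) \<in> borel_measurable M"
    by (rule borel_measurable_LIMSEQ_metric[OF simple(1) lim])
  have "(\<lambda>i. LINT \<omega>|M. (\<Prod>y\<in>#N \<omega>. s i y)) \<longlonglongrightarrow> (LINT \<omega>|M. (\<Prod>y\<in>#N \<omega>. u y))"
    by (rule integral_dominated_convergence[OF meas simple(1) int])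
      (auto simp: lim intro!: norm_prod_mset_le s2)
  moreover have "(\<lambda>i. LINT y|\<gamma>. (s i y - 1)) \<longlonglongrightarrow> (LINT y|\<gamma>. (u y - 1))"
  proof (rule integral_dominated_convergence[where w = "\<lambda>_. 3"])
    show "AE y in \<gamma>. norm (s i y - 1) \<le> 3" for i
      using s2[of i] norm_triangle_ineq4[of "s i _" 1] by (intro AE_I2) (smt (verit) norm_one)
  qed (use u s in \<open>auto intro!: tendsto_intros borel_measurable_simple_function borel_measurable_diff\<close>)
  then have "(\<lambda>i. exp (LINT y|\<gamma>. (s i y - 1))) \<longlonglongrightarrow> exp (LINT y|\<gamma>. (u y - 1))"
    by (rule tendsto_exp)
  ultimately show ?thesis
    unfolding simple(2) by (rule LIMSEQ_unique)
qed

text \<open>Standard induction on nonnegative measurable functions, starting from the mean of a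
  Poisson count. Measurability of the random sum is carried along, since the additive and monotone
  steps need it.\<close>

lemma poisson_campbell:
  fixes g :: "'b \<Rightarrow> ennreal"
  assumes N: "poisson_point_process M \<gamma> N" and "finite_measure \<gamma>" and sp: "space \<gamma> = UNIV"
    and g: "g \<in> borel_measurable \<gamma>"
  shows "(\<lambda>\<omega>. \<Sum>y\<in>#N \<omega>. g y) \<in> borel_measurable M \<and>
    (\<integral>\<^sup>+\<omega>. (\<Sum>y\<in>#N \<omega>. g y) \<partial>M) = (\<integral>\<^sup>+y. g y \<partial>\<gamma>)"
  using g
proof (induction rule: borel_measurable_induct)
  case (cong f g)
  then have "f = g" by (auto simp: sp)
  then show ?case using cong by simp
next
  case (set A)
  interpret \<gamma>: finite_measure \<gamma> by fact
  note pp = poisson_point_process_count[OF N set]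
  have "(\<Sum>y\<in>#N. indicator A y) = (of_nat (point_count A N) :: ennreal)" for N
    by (induction N) (auto simp: point_count_add_mset)
  then show ?case
    using poisson_expectation[OF pp(1) measure_nonneg pp(2)] set pp(1)
    by (auto simp: \<gamma>.emeasure_eq_measure intro: measurable_compose[OF pp(1)])
next
  case (mult u c)
  then show ?case
    by (auto simp: sum_mset_distrib_left[symmetric] nn_integral_cmult intro!: borel_measurable_times)
next
  case (add u v)
  then show ?case
    by (auto simp: sum_mset.distrib nn_integral_add intro!: borel_measurable_add)
next
  case (seq U)
  then have m: "(\<lambda>\<omega>. \<Sum>y\<in>#N \<omega>. U i y) \<in> borel_measurable M" for i by blast
  have eq: "(\<Sum>y\<in>#N \<omega>. (SUP i. U i) y) = (SUP i. \<Sum>y\<in>#N \<omega>. U i y)" for \<omega>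
    using sum_mset_SUP[OF \<open>incseq U\<close>] by (simp add: image_comp)
  have "(\<integral>\<^sup>+\<omega>. (SUP i. \<Sum>y\<in>#N \<omega>. U i y) \<partial>M) = (SUP i. \<integral>\<^sup>+\<omega>. (\<Sum>y\<in>#N \<omega>. U i y) \<partial>M)"
    using \<open>incseq U\<close> m
    by (intro nn_integral_monotone_convergence_SUP) (auto simp: incseq_def le_fun_def intro!: sum_mset_mono)
  also have "\<dots> = (SUP i. \<integral>\<^sup>+y. U i y \<partial>\<gamma>)" using seq by simp
  also have "\<dots> = (\<integral>\<^sup>+y. (SUP i. U i) y \<partial>\<gamma>)"
    using nn_integral_monotone_convergence_SUP[OF \<open>incseq U\<close>, of \<gamma>] seq(1) by (simp add: image_comp)
  finally show ?case unfolding eq using m by (auto intro!: borel_measurable_SUP)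
qed

end

subsection \<open>The branching property\<close>

lemma space_list_borel [simp]: "space list_borel = UNIV"
  by (simp add: list_borel_def)

lemma list_borel_nth_sets:
  assumes "A \<in> sets borel"
  shows "{xs. i < length xs \<and> xs ! i \<in> A} \<in> sets list_borel"
proof -
  have "{{xs. i < length xs \<and> xs ! i \<in> A} | i A. A \<in> sets borel} \<subseteq> Pow UNIV" by auto
  from sets_measure_of[OF this] show ?thesis
    using assms by (auto simp: list_borel_def)
qed

lemma measurable_list_length [measurable]:
  "length \<in> measurable (list_borel :: 'a::topological_space list measure) (count_space UNIV)"
proof (rule measurable_count_space_eq2_countable[THEN iffD2, rule_format])
  have less: "{xs :: 'a list. i < length xs} \<in> sets list_borel" for i
    using list_borel_nth_sets[of UNIV i] by simp
  show "length \<in> space list_borel \<rightarrow> UNIV \<and>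
    (\<forall>n\<in>UNIV. length -` {n} \<inter> space (list_borel :: 'a list measure) \<in> sets list_borel)"
  proof safe
    fix n
    have "length -` {n} \<inter> space (list_borel :: 'a list measure) =
        (if n = 0 then UNIV else {xs. n - 1 < length xs}) - {xs. n < length xs}"
      by auto
    also have "\<dots> \<in> sets list_borel"
      using less sets.top[of "list_borel :: 'a list measure"] by (intro sets.Diff) (simp_all split: if_split)
    finally show "length -` {n} \<inter> space (list_borel :: 'a list measure) \<in> sets list_borel" .
  qed simp
qed

text \<open>Out-of-range list access is unspecified; the default \<open>0\<close> makes it a total measurable function.\<close>

definition nth0 :: "'a::zero list \<Rightarrow> nat \<Rightarrow> 'a" where
  "nth0 xs i = (if i < length xs then xs ! i else 0)"

lemma measurable_nth0 [measurable]:
  "(\<lambda>xs. nth0 xs i) \<in> borel_measurable (list_borel :: 'a::{topological_space, zero} list measure)"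
proof (rule measurableI)
  fix A :: "'a set" assume A: "A \<in> sets borel"
  have "{xs. i < length xs} \<in> sets (list_borel :: 'a list measure)"
    using list_borel_nth_sets[of UNIV i] by simp
  from sets.compl_sets[OF this]
  have "UNIV - {xs. i < length xs} \<in> sets (list_borel :: 'a list measure)" by simp
  then have "{xs. i < length xs \<and> xs ! i \<in> A} \<union> (if 0 \<in> A then UNIV - {xs. i < length xs} else {})
      \<in> sets (list_borel :: 'a list measure)"
    by (intro sets.Un list_borel_nth_sets A) simp
  moreover have "(\<lambda>xs. nth0 xs i) -` A \<inter> space list_borel =
      {xs. i < length xs \<and> xs ! i \<in> A} \<union> (if 0 \<in> A then UNIV - {xs. i < length xs} else {})"
    by (auto simp: nth0_def split: if_splits)
  ultimately show "(\<lambda>xs. nth0 xs i) -` A \<inter> space list_borel \<in> sets list_borel"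
    by (simp only:)
qed simp

abbreviation conf_space :: "(nat list \<Rightarrow> 'a::topological_space list) measure" where
  "conf_space \<equiv> PiM UNIV (\<lambda>_. list_borel)"

lemma measurable_conf_apply [measurable]: "(\<lambda>c. c u) \<in> measurable conf_space list_borel"
  by (rule measurable_component_singleton) simp

lemma measurable_subconf [measurable]: "subconf i \<in> measurable conf_space conf_space"
  unfolding subconf_def by (rule measurable_abs_UNIV) simp

text \<open>The number of summands is random but takes countably many values, so a fixed number
  suffices; for a fixed number, positions beyond the list can occur, which is why
  \<open>nth0\<close> is used.\<close>

lemma measurable_branch_sum:
  fixes H :: "(nat list \<Rightarrow> 'a list) \<Rightarrow> 'a::euclidean_space \<Rightarrow> 'b::{second_countable_topology, topological_comm_monoid_add}"
  assumes [measurable]: "(\<lambda>(c, z). H c z) \<in> borel_measurable (conf_space \<Otimes>\<^sub>M borel)"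
  shows "(\<lambda>(c, z). \<Sum>i<length (c []). H (subconf i c) (z + c [] ! i)) \<in>
    borel_measurable (conf_space \<Otimes>\<^sub>M borel)"
proof -
  have [measurable]: "(\<lambda>x. H (subconf i (fst x)) (snd x + nth0 (fst x []) i)) \<in>
      borel_measurable (conf_space \<Otimes>\<^sub>M borel)" for i
    using measurable_compose[OF _ assms, of "\<lambda>x. (subconf i (fst x), snd x + nth0 (fst x []) i)"
        "conf_space \<Otimes>\<^sub>M borel"] by (simp add: measurable_Pair)
  have "(\<lambda>x. \<Sum>i<length (fst x []). H (subconf i (fst x)) (snd x + nth0 (fst x []) i)) \<in>
      borel_measurable (conf_space \<Otimes>\<^sub>M borel)"
    by (rule measurable_compose_countable[where g = "\<lambda>x. length (fst x [])" and
          f = "\<lambda>n x. \<Sum>i<n. H (subconf i (fst x)) (snd x + nth0 (fst x []) i)"])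
      measurable
  also have "(\<lambda>x. \<Sum>i<length (fst x []). H (subconf i (fst x)) (snd x + nth0 (fst x []) i)) =
      (\<lambda>(c, z). \<Sum>i<length (c []). H (subconf i c) (z + c [] ! i))"
    by (auto simp: fun_eq_iff nth0_def intro!: sum.cong)
  finally show ?thesis .
qed

lemma measurable_truncated_sum [measurable]:
  assumes [measurable]: "f \<in> borel_measurable borel"
  shows "(\<lambda>(c, z::'a::euclidean_space). truncated_sum f N c z) \<in> borel_measurable (conf_space \<Otimes>\<^sub>M borel)"
proof (induction N)
  case (Suc N)
  from measurable_branch_sum[OF this] show ?case
    by (simp add: split_def)
qed (simp add: split_def)

lemma measurable_total_sum [measurable]:
  assumes [measurable]: "f \<in> borel_measurable borel"
  shows "(\<lambda>(c, z::'a::euclidean_space). total_sum f c z) \<in> borel_measurable (conf_space \<Otimes>\<^sub>M borel)"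
  unfolding total_sum_def split_def
  using measurable_truncated_sum[OF assms] by (intro borel_measurable_lim_metric) (simp add: split_def)

lemma measurable_generation_sum [measurable]:
  assumes "(\<lambda>(c, z::'a::euclidean_space). F c z) \<in> borel_measurable (conf_space \<Otimes>\<^sub>M borel)"
  shows "(\<lambda>(c, z). generation_sum F m c z) \<in> borel_measurable (conf_space \<Otimes>\<^sub>M borel)"
proof (induction m)
  case (Suc m)
  from measurable_branch_sum[OF this] show ?case by simp
qed (use assms in simp)

context prob_space
begin

text \<open>The joint law is the product of the marginal laws, so Tonelli's theorem allows
  \<open>X\<close> to be frozen while \<open>Y\<close> is integrated out. This replaces conditioning
  on the root's children.\<close>

lemma indep_var_nn_integral:
  assumes ind: "indep_var S X T Y" and \<Phi> [measurable]: "\<Phi> \<in> borel_measurable (S \<Otimes>\<^sub>M T)"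
  shows "(\<integral>\<^sup>+\<omega>. \<Phi> (X \<omega>, Y \<omega>) \<partial>M) = (\<integral>\<^sup>+\<omega>. (\<integral>\<^sup>+\<omega>'. \<Phi> (X \<omega>, Y \<omega>') \<partial>M) \<partial>M)"
proof -
  note rv [measurable] = indep_var_rv1[OF ind] indep_var_rv2[OF ind]
  have eq: "distr M (S \<Otimes>\<^sub>M T) (\<lambda>\<omega>. (X \<omega>, Y \<omega>)) = distr M S X \<Otimes>\<^sub>M distr M T Y"
    using ind unfolding indep_var_distribution_eq by simp
  interpret T: prob_space "distr M T Y" by (rule prob_space_distr) simp
  have "(\<integral>\<^sup>+\<omega>. \<Phi> (X \<omega>, Y \<omega>) \<partial>M) = (\<integral>\<^sup>+p. \<Phi> p \<partial>(distr M S X \<Otimes>\<^sub>M distr M T Y))"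
    unfolding eq[symmetric] by (subst nn_integral_distr) auto
  also have "\<dots> = (\<integral>\<^sup>+x. (\<integral>\<^sup>+y. \<Phi> (x, y) \<partial>distr M T Y) \<partial>distr M S X)"
    by (rule T.nn_integral_fst[symmetric]) simp
  also have "\<dots> = (\<integral>\<^sup>+\<omega>. (\<integral>\<^sup>+\<omega>'. \<Phi> (X \<omega>, Y \<omega>') \<partial>M) \<partial>M)"
    using measurable_space[OF rv(1)]
    by (subst nn_integral_distr) (auto intro!: nn_integral_cong nn_integral_distr T.borel_measurable_nn_integral_fst)
  finally show ?thesis .
qed

lemma indep_var_integral:
  fixes \<Phi> :: "_ \<Rightarrow> 'b::{banach, second_countable_topology}"
  assumes ind: "indep_var S X T Y" and \<Phi> [measurable]: "\<Phi> \<in> borel_measurable (S \<Otimes>\<^sub>M T)"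
    and bound: "\<And>p. norm (\<Phi> p) \<le> B"
  shows "(LINT \<omega>|M. \<Phi> (X \<omega>, Y \<omega>)) = (LINT \<omega>|M. (LINT \<omega>'|M. \<Phi> (X \<omega>, Y \<omega>')))"
proof -
  note rv [measurable] = indep_var_rv1[OF ind] indep_var_rv2[OF ind]
  have eq: "distr M (S \<Otimes>\<^sub>M T) (\<lambda>\<omega>. (X \<omega>, Y \<omega>)) = distr M S X \<Otimes>\<^sub>M distr M T Y"
    using ind unfolding indep_var_distribution_eq by simp
  interpret S: prob_space "distr M S X" by (rule prob_space_distr) simp
  interpret T: prob_space "distr M T Y" by (rule prob_space_distr) simp
  interpret P: pair_prob_space "distr M S X" "distr M T Y" ..
  have int: "integrable (distr M S X \<Otimes>\<^sub>M distr M T Y) \<Phi>"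
    by (rule P.integrable_const_bound[where B = B]) (auto simp: bound)
  have "(LINT \<omega>|M. \<Phi> (X \<omega>, Y \<omega>)) = (LINT p|(distr M S X \<Otimes>\<^sub>M distr M T Y). \<Phi> p)"
    unfolding eq[symmetric] by (subst integral_distr) auto
  also have "\<dots> = (LINT x|distr M S X. (LINT y|distr M T Y. \<Phi> (x, y)))"
    by (rule P.integral_fst'[symmetric, OF int])
  also have "\<dots> = (LINT \<omega>|M. (LINT \<omega>'|M. \<Phi> (X \<omega>, Y \<omega>')))"
    using measurable_space[OF rv(1)]
    by (subst integral_distr)
      (auto intro!: Bochner_Integration.integral_cong integral_distr T.borel_measurable_lebesgue_integral)
  finally show ?thesis .
qed

end

locale branching = prob_space M for M :: "'w measure" +
  fixes \<gamma> :: "'a::euclidean_space measure"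
  assumes sets_\<gamma> [measurable_cong]: "sets \<gamma> = sets borel"
    and mass_less_1: "emeasure \<gamma> UNIV < 1"
begin

lemma space_\<gamma> [simp]: "space \<gamma> = UNIV"
  using sets_eq_imp_space_eq[OF sets_\<gamma>] by simp

sublocale \<gamma>: finite_measure \<gamma>
  by (rule finite_measureI) (use mass_less_1 in auto)

lemma offspring_measurable:
  assumes "poisson_offspring M \<gamma> off"
  shows "off u \<in> measurable M list_borel"
  using assms by (auto simp: poisson_offspring_def indep_vars_def)

lemma conf_measurable:
  assumes "poisson_offspring M \<gamma> off"
  shows "(\<lambda>\<omega> u. off u \<omega>) \<in> measurable M conf_space"
  by (rule measurable_abs_UNIV) (rule offspring_measurable[OF assms])

text \<open>The labels below one child form a copy of all labels, so the subtree satisfies the same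
  hypothesis as the whole tree. Every induction over generations rests on this.\<close>

lemma poisson_offspring_subconf:
  assumes "poisson_offspring M \<gamma> off"
  shows "poisson_offspring M \<gamma> (\<lambda>u. off (i # u))"
proof -
  have ind: "indep_vars (\<lambda>_. list_borel) off UNIV"
    using assms by (simp add: poisson_offspring_def)
  have "indep_vars (\<lambda>u. PiM {i # u} (\<lambda>_. list_borel)) (\<lambda>u \<omega>. restrict (\<lambda>u. off u \<omega>) {i # u}) UNIV"
    by (rule indep_vars_restrict[OF ind]) (auto simp: disjoint_family_on_def)
  from indep_vars_compose2[OF this, of "\<lambda>u c. c (i # u)" "\<lambda>_. list_borel"]
  have "indep_vars (\<lambda>_. list_borel) (\<lambda>u. off (i # u)) UNIV"
    by (simp add: measurable_component_singleton)
  then show ?thesis using assms by (simp add: poisson_offspring_def)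
qed

text \<open>The root's list and the lists of all other labels are each extended to full
  configurations so that both take values in \<open>conf_space\<close>. The value \<open>[]\<close>
  put at the root in the second is invisible to the subtrees.\<close>

lemma indep_root_subtrees:
  assumes "poisson_offspring M \<gamma> off"
  shows "indep_var conf_space (\<lambda>\<omega> u. off [] \<omega>)
    conf_space (\<lambda>\<omega> u. if u = [] then [] else off u \<omega>)"
proof -
  have ind: "indep_vars (\<lambda>_. list_borel) off UNIV"
    using assms by (simp add: poisson_offspring_def)
  have "indep_var (PiM {[]} (\<lambda>_. list_borel)) (\<lambda>\<omega>. restrict (\<lambda>u. off u \<omega>) {[]})
      (PiM (UNIV - {[]}) (\<lambda>_. list_borel)) (\<lambda>\<omega>. restrict (\<lambda>u. off u \<omega>) (UNIV - {[]}))"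
    by (rule indep_var_restrict[OF ind]) auto
  moreover have "(\<lambda>c u. c []) \<in> measurable (PiM {[]} (\<lambda>_. list_borel)) conf_space"
    by (intro measurable_abs_UNIV measurable_component_singleton) simp
  moreover have "(\<lambda>c u. if u = [] then [] else c u) \<in>
      measurable (PiM (UNIV - {[]}) (\<lambda>_. list_borel)) conf_space"
  proof (rule measurable_abs_UNIV)
    show "(\<lambda>c. if u = [] then [] else c u) \<in> measurable (PiM (UNIV - {[]}) (\<lambda>_. list_borel)) list_borel" for u
      by (cases "u = []") (auto intro!: measurable_component_singleton)
  qed
  ultimately have "indep_var conf_space ((\<lambda>c u. c []) \<circ> (\<lambda>\<omega>. restrict (\<lambda>u. off u \<omega>) {[]}))
      conf_space ((\<lambda>c u. if u = [] then [] else c u) \<circ> (\<lambda>\<omega>. restrict (\<lambda>u. off u \<omega>) (UNIV - {[]})))"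
    by (rule indep_var_compose)
  moreover have "(\<lambda>c (u::nat list). c []) \<circ> (\<lambda>\<omega>. restrict (\<lambda>u. off u \<omega>) {[]}) = (\<lambda>\<omega> u. off [] \<omega>)"
    "(\<lambda>c u. if u = [] then [] else c u) \<circ> (\<lambda>\<omega>. restrict (\<lambda>u. off u \<omega>) (UNIV - {[]})) =
      (\<lambda>\<omega> u. if u = [] then [] else off u \<omega>)"
    by (auto simp: fun_eq_iff)
  ultimately show ?thesis by (simp only:)
qed

text \<open>The blocks of labels \<open>range (Cons i)\<close> are pairwise disjoint.\<close>

lemma indep_subtrees:
  assumes "poisson_offspring M \<gamma> off"
  shows "indep_vars (\<lambda>_. conf_space) (\<lambda>i \<omega> u. off (i # u) \<omega>) UNIV"
proof -
  have ind: "indep_vars (\<lambda>_. list_borel) off UNIV"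
    using assms by (simp add: poisson_offspring_def)
  have "indep_vars (\<lambda>i. PiM (range (Cons i)) (\<lambda>_. list_borel))
      (\<lambda>i \<omega>. restrict (\<lambda>u. off u \<omega>) (range (Cons i))) UNIV"
    by (rule indep_vars_restrict[OF ind]) (auto simp: disjoint_family_on_def)
  moreover have "(\<lambda>c u. c (i # u)) \<in> measurable (PiM (range (Cons i)) (\<lambda>_. list_borel)) conf_space" for i
    by (intro measurable_abs_UNIV measurable_component_singleton) simp
  ultimately have "indep_vars (\<lambda>_. conf_space)
      (\<lambda>i \<omega>. (\<lambda>c u. c (i # u)) (restrict (\<lambda>u. off u \<omega>) (range (Cons i)))) UNIV"
    by (rule indep_vars_compose2)
  then show ?thesis by simp
qed

lemma measurable_subtree_functional:
  assumes off: "poisson_offspring M \<gamma> off"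
    and H: "(\<lambda>(c, z). H c z) \<in> measurable (conf_space \<Otimes>\<^sub>M borel) N"
  shows "(\<lambda>(z, \<omega>). H (\<lambda>u. off u \<omega>) z) \<in> measurable (borel \<Otimes>\<^sub>M M) N"
proof -
  note [measurable] = conf_measurable[OF off]
  from measurable_compose[OF _ H, of "\<lambda>(z, \<omega>). (\<lambda>u. off u \<omega>, z)" "borel \<Otimes>\<^sub>M M"]
  show ?thesis by (simp add: split_def measurable_Pair)
qed

lemma measurable_conf_functional:
  assumes off: "poisson_offspring M \<gamma> off"
    and H: "(\<lambda>(c, z). H c z) \<in> measurable (conf_space \<Otimes>\<^sub>M borel) N"
  shows "(\<lambda>\<omega>. H (\<lambda>u. off u \<omega>) z) \<in> measurable M N"
  using measurable_compose_Pair1[OF _ measurable_subtree_functional[OF assms], of z] by simp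

text \<open>With the root's list frozen, each child contributes the mean \<open>G\<close> at its
  position; Campbell's formula then averages over the root's list.\<close>

lemma branching_nn_integral:
  assumes off: "poisson_offspring M \<gamma> off"
    and H [measurable]: "(\<lambda>(c, z). H c z :: ennreal) \<in> borel_measurable (conf_space \<Otimes>\<^sub>M borel)"
    and G: "\<And>i y. (\<integral>\<^sup>+\<omega>. H (\<lambda>u. off (i # u) \<omega>) y \<partial>M) = G y"
  shows "(\<integral>\<^sup>+\<omega>. (\<Sum>i<length (off [] \<omega>). H (\<lambda>u. off (i # u) \<omega>) (z + off [] \<omega> ! i)) \<partial>M) =
    (\<integral>\<^sup>+y. G (z + y) \<partial>\<gamma>)"
proof -
  define R where "R = (\<lambda>\<omega> (u::nat list). off [] \<omega>)"
  define D where "D = (\<lambda>\<omega> u. if u = [] then [] else off u \<omega>)"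
  have D: "subconf i (D \<omega>) = (\<lambda>u. off (i # u) \<omega>)" for i \<omega>
    by (simp add: D_def subconf_def)
  define \<Phi> where "\<Phi> = (\<lambda>(c :: nat list \<Rightarrow> 'a list, d). \<Sum>i<length (c []). H (subconf i d) (z + nth0 (c []) i))"
  note off' = poisson_offspring_subconf[OF off]
  \<comment> \<open>The hypothesis on \<open>G\<close> holds for every child index; the index 0 is
    chosen to read off measurability.\<close>
  have "G = (\<lambda>y. \<integral>\<^sup>+\<omega>. H (\<lambda>u. off (0 # u) \<omega>) y \<partial>M)" using G by (simp add: fun_eq_iff)
  then have [measurable]: "G \<in> borel_measurable borel"
    using measurable_subtree_functional[OF off'[of 0] H] by (simp add: borel_measurable_nn_integral)
  have [measurable]: "(\<lambda>x. H (subconf i (snd x)) (z + nth0 (fst x []) i)) \<in>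
      borel_measurable (conf_space \<Otimes>\<^sub>M conf_space)" for i
    using measurable_compose[OF _ H, of "\<lambda>x. (subconf i (snd x), z + nth0 (fst x []) i)"
        "conf_space \<Otimes>\<^sub>M conf_space"] by (simp add: measurable_Pair)
  have \<Phi>: "\<Phi> \<in> borel_measurable (conf_space \<Otimes>\<^sub>M conf_space)"
    unfolding \<Phi>_def split_def
    by (rule measurable_compose_countable[where g = "\<lambda>x. length (fst x [])" and
          f = "\<lambda>n x. \<Sum>i<n. H (subconf i (snd x)) (z + nth0 (fst x []) i)"]) measurable
  have "(\<integral>\<^sup>+\<omega>. (\<Sum>i<length (off [] \<omega>). H (\<lambda>u. off (i # u) \<omega>) (z + off [] \<omega> ! i)) \<partial>M) =
      (\<integral>\<^sup>+\<omega>. \<Phi> (R \<omega>, D \<omega>) \<partial>M)"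
    by (simp add: \<Phi>_def D R_def nth0_def)
  also have "\<dots> = (\<integral>\<^sup>+\<omega>. (\<integral>\<^sup>+\<omega>'. \<Phi> (R \<omega>, D \<omega>') \<partial>M) \<partial>M)"
    unfolding D_def R_def by (rule indep_var_nn_integral[OF indep_root_subtrees[OF off] \<Phi>])
  also have "\<dots> = (\<integral>\<^sup>+\<omega>. (\<Sum>y\<in>#mset (off [] \<omega>). G (z + y)) \<partial>M)"
  proof (rule nn_integral_cong)
    fix \<omega>
    have "(\<integral>\<^sup>+\<omega>'. \<Phi> (R \<omega>, D \<omega>') \<partial>M) = (\<Sum>i<length (off [] \<omega>). G (z + off [] \<omega> ! i))"
      unfolding \<Phi>_def using measurable_conf_functional[OF off' H]
      by (simp add: nn_integral_sum G nth0_def D R_def)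
    also have "\<dots> = (\<Sum>y\<in>#mset (off [] \<omega>). G (z + y))"
      by (simp add: sum_mset_sum_list mset_map[symmetric] sum_list_sum_nth atLeast0LessThan del: mset_map)
    finally show "(\<integral>\<^sup>+\<omega>'. \<Phi> (R \<omega>, D \<omega>') \<partial>M) = (\<Sum>y\<in>#mset (off [] \<omega>). G (z + y))" .
  qed
  also have "\<dots> = (\<integral>\<^sup>+y. G (z + y) \<partial>\<gamma>)"
    using off by (intro poisson_campbell[THEN conjunct2])
      (auto simp: poisson_offspring_def \<gamma>.finite_measure_axioms)
  finally show ?thesis .
qed

text \<open>With the root's list frozen, independence of the subtrees factorises the mean of the
  product into values of \<open>G\<close>; the generating functional then averages over the root's
  list. The bound by 1 is inherited by \<open>G\<close>.\<close>

lemma branching_integral: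
  fixes H :: "(nat list \<Rightarrow> 'a list) \<Rightarrow> 'a \<Rightarrow> complex"
  assumes off: "poisson_offspring M \<gamma> off"
    and H [measurable]: "(\<lambda>(c, z). H c z) \<in> borel_measurable (conf_space \<Otimes>\<^sub>M borel)"
    and H1: "\<And>c y. norm (H c y) \<le> 1"
    and G: "\<And>i y. (LINT \<omega>|M. H (\<lambda>u. off (i # u) \<omega>) y) = G y"
  shows "(LINT \<omega>|M. (\<Prod>i<length (off [] \<omega>). H (\<lambda>u. off (i # u) \<omega>) (z + off [] \<omega> ! i))) =
    exp (LINT y|\<gamma>. (G (z + y) - 1))"
proof -
  define R where "R = (\<lambda>\<omega> (u::nat list). off [] \<omega>)"
  define D where "D = (\<lambda>\<omega> u. if u = [] then [] else off u \<omega>)"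
  have D: "subconf i (D \<omega>) = (\<lambda>u. off (i # u) \<omega>)" for i \<omega>
    by (simp add: D_def subconf_def)
  define \<Phi> where "\<Phi> = (\<lambda>(c :: nat list \<Rightarrow> 'a list, d). \<Prod>i<length (c []). H (subconf i d) (z + nth0 (c []) i))"
  note off' = poisson_offspring_subconf[OF off]
  note Hm = measurable_conf_functional[OF off' H]
  have Hint: "integrable M (\<lambda>\<omega>. H (\<lambda>u. off (i # u) \<omega>) y)" for i y
    by (rule integrable_const_bound[where B = 1]) (auto simp: H1 Hm)
  have "G = (\<lambda>y. LINT \<omega>|M. H (\<lambda>u. off (0 # u) \<omega>) y)" using G by (simp add: fun_eq_iff)
  then have [measurable]: "G \<in> borel_measurable borel"
    using measurable_subtree_functional[OF off'[of 0] H] by (simp add: borel_measurable_lebesgue_integral)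
  have G1: "norm (G y) \<le> 1" for y
    using integral_norm_bound[of M "\<lambda>\<omega>. H (\<lambda>u. off (0 # u) \<omega>) y"]
      integral_mono[OF integrable_norm[OF Hint[of 0 y]], of "\<lambda>_. 1"] 
    by (simp add: G H1 prob_space)
  have [measurable]: "(\<lambda>x. H (subconf i (snd x)) (z + nth0 (fst x []) i)) \<in>
      borel_measurable (conf_space \<Otimes>\<^sub>M conf_space)" for i
    using measurable_compose[OF _ H, of "\<lambda>x. (subconf i (snd x), z + nth0 (fst x []) i)"
        "conf_space \<Otimes>\<^sub>M conf_space"] by (simp add: measurable_Pair)
  have \<Phi>: "\<Phi> \<in> borel_measurable (conf_space \<Otimes>\<^sub>M conf_space)"
    unfolding \<Phi>_def split_def
    by (rule measurable_compose_countable[where g = "\<lambda>x. length (fst x [])" and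
          f = "\<lambda>n x. \<Prod>i<n. H (subconf i (snd x)) (z + nth0 (fst x []) i)"]) measurable
  have \<Phi>1: "norm (\<Phi> p) \<le> 1" for p
    unfolding \<Phi>_def split_def prod_norm[symmetric] by (intro prod_le_1) (auto simp: H1)
  have "(LINT \<omega>|M. (\<Prod>i<length (off [] \<omega>). H (\<lambda>u. off (i # u) \<omega>) (z + off [] \<omega> ! i))) =
      (LINT \<omega>|M. \<Phi> (R \<omega>, D \<omega>))"
    by (simp add: \<Phi>_def D R_def nth0_def)
  also have "\<dots> = (LINT \<omega>|M. (LINT \<omega>'|M. \<Phi> (R \<omega>, D \<omega>')))"
    unfolding D_def R_def by (rule indep_var_integral[OF indep_root_subtrees[OF off] \<Phi> \<Phi>1])
  also have "\<dots> = (LINT \<omega>|M. (\<Prod>y\<in>#mset (off [] \<omega>). G (z + y)))"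
  proof (rule Bochner_Integration.integral_cong[OF refl])
    fix \<omega>
    let ?l = "off [] \<omega>"
    have "indep_vars (\<lambda>_. conf_space) (\<lambda>i \<omega> u. off (i # u) \<omega>) {..<length ?l}"
      by (rule indep_vars_subset[OF indep_subtrees[OF off]]) simp
    then have "indep_vars (\<lambda>_. borel) (\<lambda>i \<omega>. H (\<lambda>u. off (i # u) \<omega>) (z + ?l ! i)) {..<length ?l}"
      by (rule indep_vars_compose2[where Y = "\<lambda>i c. H c (z + ?l ! i)"])
        (use measurable_Pair1[OF H] in simp)
    then have "(LINT \<omega>'|M. \<Phi> (R \<omega>, D \<omega>')) = (\<Prod>i<length ?l. G (z + ?l ! i))"
      unfolding \<Phi>_def
      by (simp add: indep_vars_lebesgue_integral Hint G nth0_def D R_def)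
    also have "\<dots> = (\<Prod>y\<in>#mset ?l. G (z + y))"
      by (simp add: prod_mset_prod_list mset_map[symmetric] prod.list_conv_set_nth atLeast0LessThan del: mset_map)
    finally show "(LINT \<omega>'|M. \<Phi> (R \<omega>, D \<omega>')) = (\<Prod>y\<in>#mset ?l. G (z + y))" .
  qed
  also have "\<dots> = exp (LINT y|\<gamma>. (G (z + y) - 1))"
    using off G1 by (intro poisson_generating_functional)
      (auto simp: poisson_offspring_def \<gamma>.finite_measure_axioms)
  finally show ?thesis .
qed

end

subsection \<open>The law of the cluster sum\<close>

text \<open>Integrality is what turns a generation size below 1 into extinction.\<close>

lemma generation_sum_one_nat: "\<exists>k::nat. generation_sum (\<lambda>_ _. 1) m c z = of_nat k"
proof (induction m arbitrary: c z)
  case 0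
  show ?case by (rule exI[of _ 1]) simp
next
  case (Suc m)
  then obtain k where "generation_sum (\<lambda>_ _. 1) m c z = of_nat (k c z)" for c :: "nat list \<Rightarrow> 'a list" and z
    by metis
  then show ?case
    by (intro exI[of _ "\<Sum>i<length (c []). k (subconf i c) (z + c [] ! i)"]) simp
qed

context branching
begin

definition nn_op :: "('a \<Rightarrow> ennreal) \<Rightarrow> 'a \<Rightarrow> ennreal" where
  "nn_op g z = (\<integral>\<^sup>+y. g (z + y) \<partial>\<gamma>)"

text \<open>A many-to-one formula, by induction on the first generation. The mean \<open>G\<close>
  is required to be the same for all offspring families because the induction passes to the families
  of subtrees.\<close>

lemma generation_nn_integral:
  assumes off: "poisson_offspring M \<gamma> off"
    and F: "(\<lambda>(c, z). F c z) \<in> borel_measurable (conf_space \<Otimes>\<^sub>M borel)"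
    and G: "\<And>off y. poisson_offspring M \<gamma> off \<Longrightarrow> (\<integral>\<^sup>+\<omega>. F (\<lambda>u. off u \<omega>) y \<partial>M) = G y"
  shows "(\<integral>\<^sup>+\<omega>. generation_sum F m (\<lambda>u. off u \<omega>) z \<partial>M) = (nn_op ^^ m) G z"
  using off
proof (induction m arbitrary: off z)
  case 0
  then show ?case by (simp add: G)
next
  case (Suc m)
  have "(\<integral>\<^sup>+\<omega>. generation_sum F (Suc m) (\<lambda>u. off u \<omega>) z \<partial>M) =
      (\<integral>\<^sup>+\<omega>. (\<Sum>i<length (off [] \<omega>). generation_sum F m (\<lambda>u. off (i # u) \<omega>) (z + off [] \<omega> ! i)) \<partial>M)"
    by (simp add: subconf_def)
  also have "\<dots> = (\<integral>\<^sup>+y. (nn_op ^^ m) G (z + y) \<partial>\<gamma>)"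
    by (rule branching_nn_integral[OF Suc.prems measurable_generation_sum[OF F]])
      (rule Suc.IH[OF poisson_offspring_subconf[OF Suc.prems]])
  finally show ?case by (simp add: nn_op_def[of "(nn_op ^^ m) G" z])
qed

text \<open>Subcriticality: the mean size of generation \<open>m\<close> is the \<open>m\<close>-th
  power of the total mass and tends to 0. Hence the infimum of the sizes is almost surely 0, and
  being integers they reach 0 at some generation.\<close>

lemma AE_finite_tree:
  assumes off: "poisson_offspring M \<gamma> off"
  shows "AE \<omega> in M. finite (tree (\<lambda>u. off u \<omega>))"
proof -
  let ?g = "\<lambda>m \<omega>. generation_sum (\<lambda>_ _. 1) m (\<lambda>u. off u \<omega>) (0::'a)"
  have [measurable]: "?g m \<in> borel_measurable M" for m
    by (rule measurable_conf_functional[OF off measurable_generation_sum]) simp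
  have pow: "(nn_op ^^ m) (\<lambda>_. 1) = (\<lambda>_. emeasure \<gamma> UNIV ^ m)" for m
    by (induction m) (simp_all add: fun_eq_iff nn_op_def mult.commute)
  have g: "(\<integral>\<^sup>+\<omega>. ?g m \<omega> \<partial>M) = emeasure \<gamma> UNIV ^ m" for m
    by (subst generation_nn_integral[OF off, of _ "\<lambda>_. 1"]) (simp_all add: pow emeasure_space_1)
  define r where "r = measure \<gamma> UNIV"
  have r: "emeasure \<gamma> UNIV = ennreal r" "0 \<le> r"
    by (simp_all add: r_def \<gamma>.emeasure_eq_measure)
  then have "r < 1" using mass_less_1 by (simp add: ennreal_less_one_iff)
  then have "(\<lambda>m. ennreal (r ^ m)) \<longlonglongrightarrow> ennreal 0"
    using r by (intro tendsto_ennrealI LIMSEQ_power_zero) simp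
  then have "(\<lambda>m. emeasure \<gamma> UNIV ^ m) \<longlonglongrightarrow> 0"
    using r by (simp add: ennreal_power)
  moreover have "(\<integral>\<^sup>+\<omega>. (INF m. ?g m \<omega>) \<partial>M) \<le> emeasure \<gamma> UNIV ^ m" for m
    unfolding g[symmetric] by (intro nn_integral_mono INF_lower) simp
  ultimately have "(\<integral>\<^sup>+\<omega>. (INF m. ?g m \<omega>) \<partial>M) \<le> 0"
    by (intro LIMSEQ_le_const) auto
  then have "AE \<omega> in M. (INF m. ?g m \<omega>) = 0"
    by (subst nn_integral_0_iff_AE[symmetric]) auto
  then show ?thesis
  proof (rule AE_mp, intro AE_I2 impI)
    fix \<omega> assume "(INF m. ?g m \<omega>) = 0"
    then have "(INF m. ?g m \<omega>) < 1" by simp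
    then obtain m where m: "?g m \<omega> < 1" by (auto simp: INF_less_iff)
    obtain k :: nat where k: "?g m \<omega> = of_nat k"
      using generation_sum_one_nat by blast
    with m have "k = 0" by (cases k) auto
    with k show "finite (tree (\<lambda>u. off u \<omega>))"
      by (intro finite_tree_of_generation_0[of m _ 0]) simp
  qed
qed

lemma measurable_truncated [measurable]:
  assumes "poisson_offspring M \<gamma> off" "f \<in> borel_measurable borel"
  shows "(\<lambda>\<omega>. truncated_sum f N (\<lambda>u. off u \<omega>) z) \<in> borel_measurable M"
  by (rule measurable_conf_functional[OF assms(1) measurable_truncated_sum[OF assms(2)]])

lemma measurable_total [measurable]:
  assumes "poisson_offspring M \<gamma> off" "f \<in> borel_measurable borel"
  shows "(\<lambda>\<omega>. total_sum f (\<lambda>u. off u \<omega>) z) \<in> borel_measurable M"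
  by (rule measurable_conf_functional[OF assms(1) measurable_total_sum[OF assms(2)]])

text \<open>A single \<open>G\<close> serves all offspring families on \<open>M\<close>: the
  characteristic function at level \<open>Suc N\<close> is a formula in \<open>f\<close>, \<gamma>
  and the one at level \<open>N\<close>.\<close>

lemma truncated_char_law:
  fixes t :: real
  assumes f: "f \<in> borel_measurable borel"
  shows "\<exists>G. \<forall>off z. poisson_offspring M \<gamma> off \<longrightarrow>
    (CLINT \<omega>|M. iexp (t * truncated_sum f N (\<lambda>u. off u \<omega>) z)) = G z"
proof (induction N)
  case 0
  show ?case by (rule exI[of _ "\<lambda>z. iexp (t * f z)"]) (simp add: prob_space)
next
  case (Suc N)
  then obtain G where G: "\<And>off z. poisson_offspring M \<gamma> off \<Longrightarrow>
    (CLINT \<omega>|M. iexp (t * truncated_sum f N (\<lambda>u. off u \<omega>) z)) = G z" by blast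
  have "(CLINT \<omega>|M. iexp (t * truncated_sum f (Suc N) (\<lambda>u. off u \<omega>) z)) =
      iexp (t * f z) * exp (LINT y|\<gamma>. (G (z + y) - 1))"
    if off: "poisson_offspring M \<gamma> off" for off z
  proof -
    have "iexp (t * truncated_sum f (Suc N) (\<lambda>u. off u \<omega>) z) = iexp (t * f z) *
        (\<Prod>i<length (off [] \<omega>). iexp (t * truncated_sum f N (\<lambda>u. off (i # u) \<omega>) (z + off [] \<omega> ! i)))" for \<omega>
      by (simp add: subconf_def exp_sum[symmetric] exp_add[symmetric] ring_distribs sum_distrib_left)
    then have "(CLINT \<omega>|M. iexp (t * truncated_sum f (Suc N) (\<lambda>u. off u \<omega>) z)) = iexp (t * f z) *
        (CLINT \<omega>|M. (\<Prod>i<length (off [] \<omega>). iexp (t * truncated_sum f N (\<lambda>u. off (i # u) \<omega>) (z + off [] \<omega> ! i))))"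
      by simp
    also have "\<dots> = iexp (t * f z) * exp (LINT y|\<gamma>. (G (z + y) - 1))"
    proof (rule arg_cong[OF branching_integral[OF off, where H = "\<lambda>c y. iexp (t * truncated_sum f N c y)"]])
      show "(\<lambda>(c, z). iexp (t * truncated_sum f N c z)) \<in> borel_measurable (conf_space \<Otimes>\<^sub>M borel)"
        using measurable_truncated_sum[OF f, of N] unfolding split_def by measurable
      show "(CLINT \<omega>|M. iexp (t * truncated_sum f N (\<lambda>u. off (i # u) \<omega>) y)) = G y" for i y
        by (rule G[OF poisson_offspring_subconf[OF off]])
    qed auto
    finally show ?thesis .
  qed
  then show ?case
    by (intro exI[of _ "\<lambda>z. iexp (t * f z) * exp (LINT y|\<gamma>. (G (z + y) - 1))"]) blast
qed

lemma char_truncated_tendsto: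
  assumes off: "poisson_offspring M \<gamma> off" and f: "f \<in> borel_measurable borel"
  shows "(\<lambda>N. CLINT \<omega>|M. iexp (t * truncated_sum f N (\<lambda>u. off u \<omega>) z)) \<longlonglongrightarrow>
    (CLINT \<omega>|M. iexp (t * total_sum f (\<lambda>u. off u \<omega>) z))"
proof (rule integral_dominated_convergence[where w = "\<lambda>_. 1"])
  note [measurable] = measurable_truncated[OF off f] measurable_total[OF off f]
  show "(\<lambda>\<omega>. iexp (t * total_sum f (\<lambda>u. off u \<omega>) z)) \<in> borel_measurable M"
    "(\<lambda>\<omega>. iexp (t * truncated_sum f N (\<lambda>u. off u \<omega>) z)) \<in> borel_measurable M" for N
    by measurable
  show "AE \<omega> in M. (\<lambda>N. iexp (t * truncated_sum f N (\<lambda>u. off u \<omega>) z)) \<longlonglongrightarrow>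
      iexp (t * total_sum f (\<lambda>u. off u \<omega>) z)"
    using AE_finite_tree[OF off]
    by eventually_elim
      (intro tendsto_intros, simp only: total_sum_eq truncated_sum_tendsto)
qed auto

text \<open>The characteristic functions agree as limits of those of truncated sums, so the law
  depends on the family only through \<gamma>. This identifies subtree sums with the whole cluster
  sum in law.\<close>

lemma distr_total_sum:
  assumes off: "poisson_offspring M \<gamma> off" "poisson_offspring M \<gamma> off'"
    and f: "f \<in> borel_measurable borel"
  shows "distr M borel (\<lambda>\<omega>. total_sum f (\<lambda>u. off u \<omega>) z) =
    distr M borel (\<lambda>\<omega>. total_sum f (\<lambda>u. off' u \<omega>) z)"
proof (rule Levy_uniqueness)
  note [measurable] = measurable_total[OF off(1) f] measurable_total[OF off(2) f]
  show "real_distribution (distr M borel (\<lambda>\<omega>. total_sum f (\<lambda>u. off u \<omega>) z))"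
    "real_distribution (distr M borel (\<lambda>\<omega>. total_sum f (\<lambda>u. off' u \<omega>) z))"
    by (rule real_distribution_distr, measurable)+
  show "char (distr M borel (\<lambda>\<omega>. total_sum f (\<lambda>u. off u \<omega>) z)) =
      char (distr M borel (\<lambda>\<omega>. total_sum f (\<lambda>u. off' u \<omega>) z))"
  proof (rule ext)
    fix t
    have "(CLINT \<omega>|M. iexp (t * truncated_sum f N (\<lambda>u. off u \<omega>) z)) =
        (CLINT \<omega>|M. iexp (t * truncated_sum f N (\<lambda>u. off' u \<omega>) z))" for N
      using truncated_char_law[OF f, of t N] off by metis
    then have "(CLINT \<omega>|M. iexp (t * total_sum f (\<lambda>u. off u \<omega>) z)) =
        (CLINT \<omega>|M. iexp (t * total_sum f (\<lambda>u. off' u \<omega>) z))"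
      using char_truncated_tendsto[OF off(1) f, of t z] char_truncated_tendsto[OF off(2) f, of t z]
      by (auto intro: LIMSEQ_unique)
    then show "char (distr M borel (\<lambda>\<omega>. total_sum f (\<lambda>u. off u \<omega>) z)) t =
        char (distr M borel (\<lambda>\<omega>. total_sum f (\<lambda>u. off' u \<omega>) z)) t"
      unfolding char_def by (subst (1 2) integral_distr) auto
  qed
qed

lemma integral_total_sum_cong:
  fixes h :: "real \<Rightarrow> 'b::{banach, second_countable_topology}"
  assumes off: "poisson_offspring M \<gamma> off" "poisson_offspring M \<gamma> off'"
    and f: "f \<in> borel_measurable borel" and h [measurable]: "h \<in> borel_measurable borel"
  shows "(LINT \<omega>|M. h (total_sum f (\<lambda>u. off u \<omega>) z)) = (LINT \<omega>|M. h (total_sum f (\<lambda>u. off' u \<omega>) z))"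
proof -
  note [measurable] = measurable_total[OF off(1) f] measurable_total[OF off(2) f]
  have "(LINT \<omega>|M. h (total_sum f (\<lambda>u. off u \<omega>) z)) =
      (LINT x|distr M borel (\<lambda>\<omega>. total_sum f (\<lambda>u. off u \<omega>) z). h x)"
    by (subst integral_distr) auto
  also have "\<dots> = (LINT x|distr M borel (\<lambda>\<omega>. total_sum f (\<lambda>u. off' u \<omega>) z). h x)"
    by (simp only: distr_total_sum[OF off f])
  also have "\<dots> = (LINT \<omega>|M. h (total_sum f (\<lambda>u. off' u \<omega>) z))"
    by (subst integral_distr) auto
  finally show ?thesis .
qed

lemma nn_integral_total_sum_cong:
  assumes off: "poisson_offspring M \<gamma> off" "poisson_offspring M \<gamma> off'"
    and f: "f \<in> borel_measurable borel" and h [measurable]: "h \<in> borel_measurable borel"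
  shows "(\<integral>\<^sup>+\<omega>. h (total_sum f (\<lambda>u. off u \<omega>) z) \<partial>M) = (\<integral>\<^sup>+\<omega>. h (total_sum f (\<lambda>u. off' u \<omega>) z) \<partial>M)"
proof -
  note [measurable] = measurable_total[OF off(1) f] measurable_total[OF off(2) f]
  have "(\<integral>\<^sup>+\<omega>. h (total_sum f (\<lambda>u. off u \<omega>) z) \<partial>M) =
      (\<integral>\<^sup>+x. h x \<partial>distr M borel (\<lambda>\<omega>. total_sum f (\<lambda>u. off u \<omega>) z))"
    by (subst nn_integral_distr) auto
  also have "\<dots> = (\<integral>\<^sup>+x. h x \<partial>distr M borel (\<lambda>\<omega>. total_sum f (\<lambda>u. off' u \<omega>) z))"
    by (simp only: distr_total_sum[OF off f])
  also have "\<dots> = (\<integral>\<^sup>+\<omega>. h (total_sum f (\<lambda>u. off' u \<omega>) z) \<partial>M)"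
    by (subst nn_integral_distr) auto
  finally show ?thesis .
qed

text \<open>
  The sum of the \<open>n\<close>-th powers of the subtree sums over generation \<open>m\<close> is dominated by the \<open>n\<close>-th
  power of the total sum and vanishes eventually because the tree is finite.
\<close>

lemma nn_op_moment:
  assumes off: "poisson_offspring M \<gamma> off" and f: "f \<in> borel_measurable borel" "\<And>y. 0 \<le> f y"
    and n: "1 \<le> n"
  defines "K \<equiv> \<lambda>y. \<integral>\<^sup>+\<omega>. ennreal (total_sum f (\<lambda>u. off u \<omega>) y ^ n) \<partial>M"
  assumes fin: "K z < \<infinity>"
  shows "(nn_op ^^ m) K z < \<infinity>" "(\<lambda>m. (nn_op ^^ m) K z) \<longlonglongrightarrow> 0"
proof -
  let ?F = "\<lambda>c y. ennreal (total_sum f c y ^ n)"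
  have Kz: "K z = (\<integral>\<^sup>+\<omega>. ?F (\<lambda>u. off u \<omega>) z \<partial>M)" by (simp add: K_def)
  have F: "(\<lambda>(c, z). ?F c z) \<in> borel_measurable (conf_space \<Otimes>\<^sub>M borel)"
    using measurable_total_sum[OF f(1)] unfolding split_def by measurable
  have G: "(\<integral>\<^sup>+\<omega>. ?F (\<lambda>u. off' u \<omega>) y \<partial>M) = K y" if "poisson_offspring M \<gamma> off'" for off' y
    unfolding K_def by (rule nn_integral_total_sum_cong[OF that off f(1), of "\<lambda>x. ennreal (x ^ n)"]) measurable
  have gen: "(nn_op ^^ m) K z = (\<integral>\<^sup>+\<omega>. generation_sum ?F m (\<lambda>u. off u \<omega>) z \<partial>M)" for m
    by (rule generation_nn_integral[OF off F G, symmetric])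
  have le: "AE \<omega> in M. generation_sum ?F m (\<lambda>u. off u \<omega>) z \<le> ?F (\<lambda>u. off u \<omega>) z" for m
    using AE_finite_tree[OF off] by eventually_elim (rule generation_sum_power_le[OF _ f(2) n])
  have [measurable]: "(\<lambda>\<omega>. generation_sum ?F m (\<lambda>u. off u \<omega>) z) \<in> borel_measurable M" for m
    by (rule measurable_conf_functional[OF off measurable_generation_sum[OF F]])
  have [measurable]: "(\<lambda>\<omega>. ?F (\<lambda>u. off u \<omega>) z) \<in> borel_measurable M"
    by (rule measurable_conf_functional[OF off F])
  have "(nn_op ^^ m) K z \<le> K z"
    unfolding gen Kz by (rule nn_integral_mono_AE[OF le])
  also have "\<dots> < \<infinity>" by fact
  finally show "(nn_op ^^ m) K z < \<infinity>" .
  have "(\<lambda>m. \<integral>\<^sup>+\<omega>. generation_sum ?F m (\<lambda>u. off u \<omega>) z \<partial>M) \<longlonglongrightarrow> (\<integral>\<^sup>+\<omega>. 0 \<partial>M)"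
  proof (rule nn_integral_dominated_convergence[where w = "\<lambda>\<omega>. ?F (\<lambda>u. off u \<omega>) z"])
    show "(\<integral>\<^sup>+\<omega>. ?F (\<lambda>u. off u \<omega>) z \<partial>M) < \<infinity>"
      using fin by (simp add: K_def)
    show "AE \<omega> in M. (\<lambda>m. generation_sum ?F m (\<lambda>u. off u \<omega>) z) \<longlonglongrightarrow> 0"
      using AE_finite_tree[OF off]
      by eventually_elim (rule tendsto_eventually[OF generation_sum_eventually_0])
  qed (auto simp: le)
  then show "(\<lambda>m. (nn_op ^^ m) K z) \<longlonglongrightarrow> 0"
    by (simp add: gen)
qed

text \<open>Pointwise domination by \<open>K\<close> survives each application of the operator;
  integrability of an iterate then follows from finiteness of the next iterate of
  \<open>K\<close>.\<close>

lemma offspring_op_iterate: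
  assumes g: "g \<in> borel_measurable borel" "\<And>y. ennreal \<bar>g y\<bar> \<le> K y"
    and K: "\<And>m z. (nn_op ^^ m) K z < \<infinity>"
  shows "(offspring_op \<gamma> ^^ m) g \<in> borel_measurable borel"
    and "ennreal \<bar>(offspring_op \<gamma> ^^ m) g z\<bar> \<le> (nn_op ^^ m) K z"
    and "integrable \<gamma> (\<lambda>y. (offspring_op \<gamma> ^^ m) g (z + y))"
proof -
  have *: "(offspring_op \<gamma> ^^ m) g \<in> borel_measurable borel \<and>
      (\<forall>z. ennreal \<bar>(offspring_op \<gamma> ^^ m) g z\<bar> \<le> (nn_op ^^ m) K z)" for m
  proof (induction m)
    case (Suc m)
    then have [measurable]: "(offspring_op \<gamma> ^^ m) g \<in> borel_measurable borel" by blast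
    have "(\<lambda>z. LINT y|\<gamma>. (offspring_op \<gamma> ^^ m) g (z + y)) \<in> borel_measurable borel"
      by measurable
    moreover have "ennreal \<bar>LINT y|\<gamma>. (offspring_op \<gamma> ^^ m) g (z + y)\<bar> \<le> nn_op ((nn_op ^^ m) K) z" for z
    proof -
      have "ennreal \<bar>LINT y|\<gamma>. (offspring_op \<gamma> ^^ m) g (z + y)\<bar> \<le>
          (\<integral>\<^sup>+y. ennreal \<bar>(offspring_op \<gamma> ^^ m) g (z + y)\<bar> \<partial>\<gamma>)"
      \<comment> \<open>The Bochner integral of a non-integrable function is 0 by convention, so the
        bound holds in either case and does not presuppose the integrability proved
        afterwards.\<close>
      proof (cases "integrable \<gamma> (\<lambda>y. (offspring_op \<gamma> ^^ m) g (z + y))")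
        case True
        then show ?thesis using integral_norm_bound_ennreal[OF True] by simp
      qed (simp add: not_integrable_integral_eq)
      also have "\<dots> \<le> nn_op ((nn_op ^^ m) K) z"
        unfolding nn_op_def[of "(nn_op ^^ m) K" z] using Suc by (intro nn_integral_mono) auto
      finally show ?thesis .
    qed
    ultimately show ?case by (simp add: offspring_op_def[abs_def])
  qed (use g in auto)
  then show m [measurable]: "(offspring_op \<gamma> ^^ m) g \<in> borel_measurable borel" for m by blast
  from * show "ennreal \<bar>(offspring_op \<gamma> ^^ m) g z\<bar> \<le> (nn_op ^^ m) K z" by blast
  show "integrable \<gamma> (\<lambda>y. (offspring_op \<gamma> ^^ m) g (z + y))"
  proof (rule integrableI_bounded)
    have "(\<integral>\<^sup>+y. ennreal (norm ((offspring_op \<gamma> ^^ m) g (z + y))) \<partial>\<gamma>) \<le> (nn_op ^^ Suc m) K z"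
      using * by (auto simp: nn_op_def[of "(nn_op ^^ m) K" z] intro!: nn_integral_mono)
    then show "(\<integral>\<^sup>+y. ennreal (norm ((offspring_op \<gamma> ^^ m) g (z + y))) \<partial>\<gamma>) < \<infinity>"
      using K[of "Suc m" z] by (rule le_less_trans)
  qed measurable
qed

end

subsection \<open>Moments and cumulants\<close>

text \<open>Dominated convergence for the normalised linearisation error along sequences. The mean
  value inequality bounds it by the largest value of \<open>norm (F' u x - F' t x)\<close>, hence by
  \<open>2 * B x\<close>.\<close>

lemma has_vector_derivative_integral:
  fixes F F' :: "real \<Rightarrow> 'x \<Rightarrow> 'b::{banach, second_countable_topology}"
  assumes der: "\<And>t x. x \<in> space \<mu> \<Longrightarrow> ((\<lambda>t. F t x) has_vector_derivative F' t x) (at t)"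
    and int: "\<And>t. integrable \<mu> (F t)" and int': "\<And>t. integrable \<mu> (F' t)"
    and bound: "\<And>t x. x \<in> space \<mu> \<Longrightarrow> norm (F' t x) \<le> B x" "integrable \<mu> B"
  shows "((\<lambda>t. LINT x|\<mu>. F t x) has_vector_derivative (LINT x|\<mu>. F' t x)) (at t)"
  unfolding has_vector_derivative_def has_derivative_at_within
proof (intro conjI bounded_linear_scaleR_left)
  show "((\<lambda>s. ((LINT x|\<mu>. F s x) - (LINT x|\<mu>. F t x) - (s - t) *\<^sub>R (LINT x|\<mu>. F' t x)) /\<^sub>R norm (s - t)) \<longlongrightarrow> 0) (at t)"
    unfolding tendsto_at_iff_sequentially comp_def
  proof (intro allI impI)
    fix s :: "nat \<Rightarrow> real" assume s: "\<forall>i. s i \<in> UNIV - {t}" "s \<longlonglongrightarrow> t"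
    let ?q = "\<lambda>i x. (F (s i) x - F t x - (s i - t) *\<^sub>R F' t x) /\<^sub>R norm (s i - t)"
    have lim: "(\<lambda>i. LINT x|\<mu>. ?q i x) \<longlonglongrightarrow> (LINT x|\<mu>. 0)"
    proof (rule integral_dominated_convergence[where w = "\<lambda>x. 2 * B x"])
      show "AE x in \<mu>. (\<lambda>i. ?q i x) \<longlonglongrightarrow> 0"
      proof (rule AE_I2)
        fix x assume "x \<in> space \<mu>"
        then have "((\<lambda>s. (F s x - F t x - (s - t) *\<^sub>R F' t x) /\<^sub>R norm (s - t)) \<longlongrightarrow> 0) (at t)"
          using der[of x t] by (simp add: has_vector_derivative_def has_derivative_at_within)
        then show "(\<lambda>i. ?q i x) \<longlonglongrightarrow> 0"
          using s unfolding tendsto_at_iff_sequentially comp_def by blast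
      qed
      show "AE x in \<mu>. norm (?q i x) \<le> 2 * B x" for i
      proof (rule AE_I2)
        fix x assume x: "x \<in> space \<mu>"
        have "norm (F (s i) x - F t x - (s i - t) *\<^sub>R F' t x) \<le> norm (s i - t) * (2 * B x)"
        proof (rule vector_differentiable_bound_linearization[where S = UNIV])
          show "norm (F' u x - F' t x) \<le> 2 * B x" for u
            using norm_triangle_ineq4[of "F' u x" "F' t x"] bound(1)[OF x, of u] bound(1)[OF x, of t] by simp
        qed (auto intro: der[OF x])
        moreover have "norm (s i - t) > 0" using s by simp
        moreover have "norm (?q i x) = norm (F (s i) x - F t x - (s i - t) *\<^sub>R F' t x) / norm (s i - t)"
          by (simp only: norm_scaleR real_norm_def abs_inverse abs_abs divide_inverse mult.commute)
        ultimately show "norm (?q i x) \<le> 2 * B x"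
          by (simp only: pos_divide_le_eq mult.commute)
      qed
      show "?q i \<in> borel_measurable \<mu>" for i
        using int[THEN borel_measurable_integrable] int'[THEN borel_measurable_integrable]
        by (intro borel_measurable_scaleR borel_measurable_diff) auto
    qed (use bound in auto)
    have eq: "(LINT x|\<mu>. ?q i x) = ((LINT x|\<mu>. F (s i) x) - (LINT x|\<mu>. F t x) - (s i - t) *\<^sub>R (LINT x|\<mu>. F' t x)) /\<^sub>R norm (s i - t)" for i
      using int int' by simp
    show "(\<lambda>i. ((LINT x|\<mu>. F (s i) x) - (LINT x|\<mu>. F t x) - (s i - t) *\<^sub>R (LINT x|\<mu>. F' t x)) /\<^sub>R norm (s i - t)) \<longlonglongrightarrow> 0"
      using lim unfolding eq Bochner_Integration.integral_zero .
  qed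
qed

text \<open>The normalisation by \<open>fact n\<close> produces exactly the factor
  \<open>of_nat (Suc n)\<close> required by \<open>taylor_family_ode\<close>.\<close>

lemma has_vector_derivative_exp_family:
  fixes x t :: real
  shows "((\<lambda>t. (\<i> * x) ^ n / fact n * iexp (t * x)) has_vector_derivative
    of_nat (Suc n) * ((\<i> * x) ^ Suc n / fact (Suc n) * iexp (t * x))) (at t)"
proof -
  have "((\<lambda>s. exp (s * (\<i> * x))) has_field_derivative exp (of_real t * (\<i> * x)) * (\<i> * x)) (at (of_real t))"
    by (auto intro!: derivative_eq_intros)
  then have "((\<lambda>t. exp (of_real t * (\<i> * x))) has_vector_derivative exp (of_real t * (\<i> * x)) * (\<i> * x)) (at t)"
    by (rule has_vector_derivative_real_field)
  from has_vector_derivative_mult_right[OF this, of "(\<i> * x) ^ n / fact n"]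
  show ?thesis by (simp add: field_simps del: of_nat_Suc)
qed

lemma norm_exp_family_le:
  fixes x t :: real
  shows "norm ((\<i> * x) ^ n / fact n * iexp (t * x)) \<le> \<bar>x\<bar> ^ n"
proof -
  have "norm ((\<i> * x) ^ n / fact n * iexp (t * x)) = \<bar>x\<bar> ^ n / fact n"
    by (simp add: norm_mult norm_power norm_divide power_mult_distrib)
  also have "\<dots> \<le> \<bar>x\<bar> ^ n / 1"
    by (intro divide_left_mono) (auto simp: fact_ge_1)
  finally show ?thesis by simp
qed

text \<open>The moment condition concerns only the absolute value of \<open>f\<close>, so the locale
  can be interpreted once more with that function in place of \<open>f\<close>.\<close>

locale cluster_moments = branching M \<gamma> for M :: "'w measure" and \<gamma> :: "'a::euclidean_space measure" +
  fixes off :: "nat list \<Rightarrow> 'w \<Rightarrow> 'a list" and f :: "'a \<Rightarrow> real"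
  assumes off: "poisson_offspring M \<gamma> off"
    and f [measurable]: "f \<in> borel_measurable borel"
    and moments_finite: "\<And>n z. 1 \<le> n \<Longrightarrow>
      (\<integral>\<^sup>+\<omega>. ennreal (total_sum (\<lambda>y. \<bar>f y\<bar>) (\<lambda>u. off u \<omega>) z ^ n) \<partial>M) < \<infinity>"
begin

definition S :: "'a \<Rightarrow> 'w \<Rightarrow> real" where
  "S z \<omega> = total_sum f (\<lambda>u. off u \<omega>) z"

definition T :: "'a \<Rightarrow> 'w \<Rightarrow> real" where
  "T z \<omega> = total_sum (\<lambda>y. \<bar>f y\<bar>) (\<lambda>u. off u \<omega>) z"

definition moment :: "nat \<Rightarrow> 'a \<Rightarrow> real" where
  "moment n z = (LINT \<omega>|M. S z \<omega> ^ n)"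

definition abs_moment :: "nat \<Rightarrow> 'a \<Rightarrow> ennreal" where
  "abs_moment n z = (\<integral>\<^sup>+\<omega>. ennreal (T z \<omega> ^ n) \<partial>M)"

lemma S_measurable [measurable]: "(\<lambda>(z, \<omega>). S z \<omega>) \<in> borel_measurable (borel \<Otimes>\<^sub>M M)"
  unfolding S_def by (rule measurable_subtree_functional[OF off measurable_total_sum[OF f]])

lemma AE_S_le_T: "AE \<omega> in M. \<bar>S z \<omega>\<bar> \<le> T z \<omega>"
  using AE_finite_tree[OF off] by eventually_elim (simp add: S_def T_def abs_total_sum_le)

lemma abs_moment_iterate:
  assumes "1 \<le> n"
  shows "(nn_op ^^ m) (abs_moment n) z < \<infinity>" "(\<lambda>m. (nn_op ^^ m) (abs_moment n) z) \<longlonglongrightarrow> 0"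
  using nn_op_moment[OF off _ _ assms, of "\<lambda>y. \<bar>f y\<bar>" z] moments_finite[OF assms]
  unfolding abs_moment_def T_def by auto

lemma abs_moment_finite: "abs_moment n z < \<infinity>"
  using abs_moment_iterate(1)[of n 0 z]
  by (cases n) (simp_all add: abs_moment_def emeasure_space_1)

lemma integrable_power: "integrable M (\<lambda>\<omega>. S z \<omega> ^ n)"
proof (rule integrableI_bounded)
  have "(\<integral>\<^sup>+\<omega>. ennreal (norm (S z \<omega> ^ n)) \<partial>M) \<le> abs_moment n z"
    unfolding abs_moment_def
  proof (rule nn_integral_mono_AE)
    show "AE \<omega> in M. ennreal (norm (S z \<omega> ^ n)) \<le> ennreal (T z \<omega> ^ n)"
      using AE_S_le_T[of z] by eventually_elim (auto simp: power_abs intro!: ennreal_leI power_mono)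
  qed
  then show "(\<integral>\<^sup>+\<omega>. ennreal (norm (S z \<omega> ^ n)) \<partial>M) < \<infinity>"
    using abs_moment_finite by (rule le_less_trans)
qed measurable

text \<open>This is a moment of \<open>\<bar>S z \<omega>\<bar>\<close>, whereas
  \<open>abs_moment\<close> uses the sum \<open>T\<close> of absolute values. It serves as a real
  dominating function when differentiating under \<gamma>.\<close>

definition real_abs_moment :: "nat \<Rightarrow> 'a \<Rightarrow> real" where
  "real_abs_moment n z = (LINT \<omega>|M. \<bar>S z \<omega>\<bar> ^ n)"

lemma integrable_abs_power: "integrable M (\<lambda>\<omega>. \<bar>S z \<omega>\<bar> ^ n)"
  using integrable_norm[OF integrable_power[of z n]] by (simp add: power_abs)

lemma real_abs_moment_measurable [measurable]: "real_abs_moment n \<in> borel_measurable borel"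
  unfolding real_abs_moment_def by measurable

lemma real_abs_moment_le: "ennreal \<bar>real_abs_moment n z\<bar> \<le> abs_moment n z"
proof -
  have "ennreal \<bar>real_abs_moment n z\<bar> = (\<integral>\<^sup>+\<omega>. ennreal (\<bar>S z \<omega>\<bar> ^ n) \<partial>M)"
    unfolding real_abs_moment_def using integrable_abs_power by (subst nn_integral_eq_integral) auto
  also have "\<dots> \<le> abs_moment n z"
    unfolding abs_moment_def
  proof (rule nn_integral_mono_AE)
    show "AE \<omega> in M. ennreal (\<bar>S z \<omega>\<bar> ^ n) \<le> ennreal (T z \<omega> ^ n)"
      using AE_S_le_T[of z] by eventually_elim (auto intro!: ennreal_leI power_mono)
  qed
  finally show ?thesis .
qed

lemma integrable_real_abs_moment:
  assumes "1 \<le> n" shows "integrable \<gamma> (\<lambda>y. real_abs_moment n (z + y))"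
  using offspring_op_iterate(3)[OF real_abs_moment_measurable real_abs_moment_le abs_moment_iterate(1)[OF assms], of 0]
  by simp

lemma moment_measurable [measurable]: "moment n \<in> borel_measurable borel"
  unfolding moment_def by measurable

lemma moment_le_real_abs_moment: "\<bar>moment n z\<bar> \<le> real_abs_moment n z"
proof -
  have "norm (LINT \<omega>|M. S z \<omega> ^ n) \<le> (LINT \<omega>|M. norm (S z \<omega> ^ n))"
    by (rule integral_norm_bound)
  then show ?thesis
    by (simp only: moment_def real_abs_moment_def real_norm_def power_abs)
qed

lemma moment_le: "ennreal \<bar>moment n z\<bar> \<le> abs_moment n z"
proof -
  have "\<bar>moment n z\<bar> \<le> \<bar>real_abs_moment n z\<bar>"
    using moment_le_real_abs_moment[of n z] by linarith
  then show ?thesis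
    by (rule order_trans[OF ennreal_leI real_abs_moment_le])
qed

lemma moment_0 [simp]: "moment 0 z = 1"
  by (simp add: moment_def prob_space)

text \<open>The \<open>n\<close>-th Taylor coefficient at \<open>t\<close> of the characteristic
  function of \<open>S z\<close>; the case \<open>n = 0\<close> is the characteristic function
  itself.\<close>

definition taylor :: "'a \<Rightarrow> nat \<Rightarrow> real \<Rightarrow> complex" where
  "taylor z n t = (CLINT \<omega>|M. (\<i> * S z \<omega>) ^ n / fact n * iexp (t * S z \<omega>))"

lemma integrable_taylor: "integrable M (\<lambda>\<omega>. (\<i> * S z \<omega>) ^ n / fact n * iexp (t * S z \<omega>))"
proof (rule Bochner_Integration.integrable_bound[OF integrable_abs_power[of z n]])
  show "AE \<omega> in M. norm ((\<i> * S z \<omega>) ^ n / fact n * iexp (t * S z \<omega>)) \<le> norm (\<bar>S z \<omega>\<bar> ^ n)"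
    by (rule AE_I2) (rule order_trans[OF norm_exp_family_le], simp)
qed measurable

lemma taylor_measurable [measurable]: "(\<lambda>z. taylor z n t) \<in> borel_measurable borel"
  unfolding taylor_def by measurable

lemma taylor_bound: "norm (taylor z n t) \<le> real_abs_moment n z"
proof -
  have "norm (taylor z n t) \<le> (LINT \<omega>|M. norm ((\<i> * S z \<omega>) ^ n / fact n * iexp (t * S z \<omega>)))"
    unfolding taylor_def by (rule integral_norm_bound)
  also have "\<dots> \<le> real_abs_moment n z"
    unfolding real_abs_moment_def
    by (intro integral_mono integrable_norm integrable_taylor integrable_abs_power norm_exp_family_le)
  finally show ?thesis .
qed

lemma taylor_derivative:
  "((taylor z n) has_vector_derivative of_nat (Suc n) * taylor z (Suc n) t) (at t)"
proof -
  have "((\<lambda>t. CLINT \<omega>|M. (\<i> * S z \<omega>) ^ n / fact n * iexp (t * S z \<omega>)) has_vector_derivative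
      (CLINT \<omega>|M. of_nat (Suc n) * ((\<i> * S z \<omega>) ^ Suc n / fact (Suc n) * iexp (t * S z \<omega>)))) (at t)"
  proof (rule has_vector_derivative_integral[OF has_vector_derivative_exp_family integrable_taylor])
    show "integrable M (\<lambda>\<omega>. of_nat (Suc n) * ((\<i> * S z \<omega>) ^ Suc n / fact (Suc n) * iexp (t * S z \<omega>)))" for t
      by (intro integrable_mult_right integrable_taylor)
    show "integrable M (\<lambda>\<omega>. real (Suc n) * \<bar>S z \<omega>\<bar> ^ Suc n)"
      by (intro integrable_mult_right integrable_abs_power)
    show "norm (of_nat (Suc n) * ((\<i> * S z \<omega>) ^ Suc n / fact (Suc n) * iexp (t * S z \<omega>)))
        \<le> real (Suc n) * \<bar>S z \<omega>\<bar> ^ Suc n" for t \<omega>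
      unfolding norm_mult[of "of_nat (Suc n)"] norm_of_nat
      by (intro mult_left_mono norm_exp_family_le) simp
  qed
  then show ?thesis
    by (simp add: taylor_def[abs_def] del: power_Suc fact_Suc of_nat_Suc)
qed

text \<open>The root recursion makes the exponential a product over the children, to which
  \<open>branching_integral\<close> applies; equality in law identifies the subtree factors with
  \<open>taylor y 0 t\<close>.\<close>

lemma taylor_0_functional:
  "taylor z 0 t = iexp (t * f z) * exp (LINT y|\<gamma>. (taylor (z + y) 0 t - 1))"
proof -
  have tay: "taylor z 0 t = (CLINT \<omega>|M. iexp (t * total_sum f (\<lambda>u. off u \<omega>) z))" for z
    by (simp add: taylor_def S_def)
  have m: "(\<lambda>\<omega>. iexp (t * total_sum f (\<lambda>u. off u \<omega>) z)) \<in> borel_measurable M"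
    using measurable_total[OF off f, of z] by measurable
  have H: "(\<lambda>(c, z). iexp (t * total_sum f c z)) \<in> borel_measurable (conf_space \<Otimes>\<^sub>M borel)"
    using measurable_total_sum[OF f] unfolding split_def by measurable
  have Hm: "(\<lambda>\<omega>. (\<Prod>i<length (off [] \<omega>).
      iexp (t * total_sum f (\<lambda>u. off (i # u) \<omega>) (z + off [] \<omega> ! i)))) \<in> borel_measurable M"
  proof (rule measurable_compose_countable[where f = "\<lambda>n \<omega>. \<Prod>i<n. iexp (t * total_sum f (\<lambda>u. off (i # u) \<omega>) (z + nth0 (off [] \<omega>) i))"
        and g = "\<lambda>\<omega>. length (off [] \<omega>)", THEN measurable_cong[THEN iffD1, rotated]])
    fix n
    have "(\<lambda>\<omega>. total_sum f (\<lambda>u. off (i # u) \<omega>) (z + nth0 (off [] \<omega>) i)) \<in> borel_measurable M" for i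
      using measurable_compose[OF _ measurable_total_sum[OF f], of "\<lambda>\<omega>. ((\<lambda>u. off (i # u) \<omega>), z + nth0 (off [] \<omega>) i)" M]
        conf_measurable[OF poisson_offspring_subconf[OF off]]
        measurable_compose[OF offspring_measurable[OF off, of "[]"] measurable_nth0[of i]]
      by (simp add: measurable_Pair)
    then show "(\<lambda>\<omega>. \<Prod>i<n. iexp (t * total_sum f (\<lambda>u. off (i # u) \<omega>) (z + nth0 (off [] \<omega>) i))) \<in> borel_measurable M"
      by measurable
  next
    show "(\<lambda>\<omega>. length (off [] \<omega>)) \<in> measurable M (count_space UNIV)"
      by (rule measurable_compose[OF offspring_measurable[OF off] measurable_list_length])
  qed (simp add: nth0_def)
  have "(CLINT \<omega>|M. iexp (t * total_sum f (\<lambda>u. off u \<omega>) z)) = (CLINT \<omega>|M. iexp (t * f z) *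
      (\<Prod>i<length (off [] \<omega>). iexp (t * total_sum f (\<lambda>u. off (i # u) \<omega>) (z + off [] \<omega> ! i))))"
  \<comment> \<open>The recursion is available only where the tree is finite, so the integrands
    agree almost surely; this is why the measurability of both had to be shown.\<close>
  proof (rule integral_cong_AE[OF m])
    show "AE \<omega> in M. iexp (t * total_sum f (\<lambda>u. off u \<omega>) z) = iexp (t * f z) *
      (\<Prod>i<length (off [] \<omega>). iexp (t * total_sum f (\<lambda>u. off (i # u) \<omega>) (z + off [] \<omega> ! i)))"
      using AE_finite_tree[OF off]
      by eventually_elim
        (simp add: total_sum_rec subconf_def exp_sum[symmetric] exp_add[symmetric] ring_distribs sum_distrib_left)
  qed (use Hm in simp)
  also have "\<dots> = iexp (t * f z) * exp (LINT y|\<gamma>. (taylor (z + y) 0 t - 1))"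
    unfolding integral_mult_right_zero
  proof (rule arg_cong[OF branching_integral[OF off H]])
    show "(CLINT \<omega>|M. iexp (t * total_sum f (\<lambda>u. off (i # u) \<omega>) y)) = taylor y 0 t" for i y
      unfolding tay
      by (rule integral_total_sum_cong[OF poisson_offspring_subconf[OF off] off f, of "\<lambda>x. iexp (t * x)"]) measurable
  qed auto
  finally show ?thesis by (simp only: tay)
qed

text \<open>The Taylor coefficients of the exponent in \<open>taylor_0_functional\<close>, so that
  no branch of the logarithm has to be chosen. The linear term contributes in degrees 0 and 1 only,
  the subtracted 1 in degree 0 only.\<close>

definition taylor_log :: "'a \<Rightarrow> nat \<Rightarrow> real \<Rightarrow> complex" where
  "taylor_log z n t = (if n = 0 then \<i> * (t * f z) else if n = 1 then \<i> * f z else 0) +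
    (LINT y|\<gamma>. (taylor (z + y) n t - (if n = 0 then 1 else 0)))"

lemma taylor_log_derivative:
  "((taylor_log z n) has_vector_derivative of_nat (Suc n) * taylor_log z (Suc n) t) (at t)"
proof -
  have "((\<lambda>t. (if n = 0 then \<i> * (t * f z) else if n = 1 then \<i> * f z else 0)) has_vector_derivative
      (if n = 0 then \<i> * f z else 0)) (at t)"
    by (auto intro!: derivative_eq_intros simp: has_vector_derivative_def scaleR_conv_of_real mult_ac)
  moreover have "((\<lambda>t. LINT y|\<gamma>. (taylor (z + y) n t - (if n = 0 then 1 else 0))) has_vector_derivative
      (LINT y|\<gamma>. of_nat (Suc n) * taylor (z + y) (Suc n) t)) (at t)"
  proof (rule has_vector_derivative_integral)
    show "((\<lambda>t. taylor (z + y) n t - (if n = 0 then 1 else 0)) has_vector_derivative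
        of_nat (Suc n) * taylor (z + y) (Suc n) t) (at t)" for y t
      using has_vector_derivative_diff[OF taylor_derivative has_vector_derivative_const] by simp
    \<comment> \<open>Degree 0 needs its own bound: the constant 1, integrable since \<gamma> is
      finite, because \<open>integrable_real_abs_moment\<close> starts at degree 1.\<close>
    have B0: "real_abs_moment 0 y = 1" for y by (simp add: real_abs_moment_def prob_space)
    have int: "integrable \<gamma> (\<lambda>y. taylor (z + y) n t)" for n t
    proof (rule Bochner_Integration.integrable_bound)
      show "integrable \<gamma> (\<lambda>y. real_abs_moment n (z + y))"
        using integrable_real_abs_moment by (cases "n = 0") (auto simp: B0)
      show "AE y in \<gamma>. norm (taylor (z + y) n t) \<le> norm (real_abs_moment n (z + y))"
        by (intro AE_I2) (rule order_trans[OF taylor_bound], simp)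
    qed measurable
    then show "integrable \<gamma> (\<lambda>y. taylor (z + y) n t - (if n = 0 then 1 else 0))"
      "integrable \<gamma> (\<lambda>y. of_nat (Suc n) * taylor (z + y) (Suc n) t)" for t
      by auto
    show "integrable \<gamma> (\<lambda>y. real (Suc n) * real_abs_moment (Suc n) (z + y))"
      by (intro integrable_mult_right integrable_real_abs_moment) simp
    show "norm (of_nat (Suc n) * taylor (z + y) (Suc n) t) \<le> real (Suc n) * real_abs_moment (Suc n) (z + y)" for y t
      by (simp add: norm_mult taylor_bound mult_left_mono del: of_nat_Suc)
  qed
  ultimately have *: "((taylor_log z n) has_vector_derivative (if n = 0 then \<i> * f z else 0) +
      (LINT y|\<gamma>. of_nat (Suc n) * taylor (z + y) (Suc n) t)) (at t)"
    unfolding taylor_log_def[abs_def] by (rule has_vector_derivative_add)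
  then show ?thesis
  proof (cases "n = 0")
    case False
    with * show ?thesis by (simp add: taylor_log_def del: of_nat_Suc)
  qed (simp add: taylor_log_def)
qed

text \<open>Only the first-order identity needs an argument: the characteristic function is
  differentiated once under the expectation and once through the functional equation. The higher
  orders follow from \<open>taylor_family_ode\<close>.\<close>

lemma taylor_ode:
  "fps_deriv (Abs_fps (\<lambda>n. taylor z n t)) =
    fps_deriv (Abs_fps (\<lambda>n. taylor_log z n t)) * Abs_fps (\<lambda>n. taylor z n t)"
proof (rule taylor_family_ode[OF taylor_derivative taylor_log_derivative])
  fix t
  have eq: "taylor z 0 = (\<lambda>t. exp (taylor_log z 0 t))"
    using taylor_0_functional[of z] by (simp add: fun_eq_iff taylor_log_def exp_add)
  have "((\<lambda>t. exp (taylor_log z 0 t)) has_vector_derivative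
      (of_nat (Suc 0) * taylor_log z (Suc 0) t) * exp (taylor_log z 0 t)) (at t)"
    using field_vector_diff_chain_at[OF taylor_log_derivative[of z 0 t] DERIV_exp] by (simp add: comp_def)
  then have "((taylor z 0) has_vector_derivative taylor_log z 1 t * taylor z 0 t) (at t)"
    by (simp add: eq)
  moreover have "((taylor z 0) has_vector_derivative taylor z 1 t) (at t)"
    using taylor_derivative[of z 0 t] by simp
  ultimately show "taylor z 1 t = taylor_log z 1 t * taylor z 0 t"
    by (rule vector_derivative_unique_at[rotated])
qed

text \<open>The cumulant of a compound Poisson sum is the integrated moment of its marks. Here the
  marks are the subtree sums, and the constant \<open>f z\<close> affects only the first
  cumulant.\<close>

definition cluster_cumulant :: "'a \<Rightarrow> nat \<Rightarrow> real" where
  "cluster_cumulant z n = (if n = 1 then f z else 0) + offspring_op \<gamma> (moment n) z"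

text \<open>This is \<open>taylor_ode\<close> at \<open>t = 0\<close>. Coefficients of index
  \<open>j\<close> carry \<open>\<i> ^ j\<close>, and these powers combine to a common factor in
  each degree, which cancels and leaves a real identity.\<close>

lemma moment_ode:
  "fps_deriv (Abs_fps (\<lambda>n. moment n z / fact n)) =
    fps_deriv (Abs_fps (\<lambda>n. if n = 0 then 0 else cluster_cumulant z n / fact n)) * Abs_fps (\<lambda>n. moment n z / fact n)"
    (is "fps_deriv ?P = fps_deriv ?A * ?P")
proof (rule fps_ext)
  fix n
  have P: "taylor z n 0 = \<i> ^ n * of_real (moment n z / fact n)" for z n
  proof -
    have "taylor z n 0 = (CLINT \<omega>|M. \<i> ^ n / fact n * complex_of_real (S z \<omega> ^ n))"
      by (simp add: taylor_def power_mult_distrib)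
    also have "\<dots> = \<i> ^ n / fact n * of_real (moment n z)"
      by (simp only: integral_mult_right_zero integral_complex_of_real moment_def)
    finally show ?thesis by simp
  qed
  have A: "taylor_log z (Suc n) 0 = \<i> ^ Suc n * of_real (fps_nth ?A (Suc n))" for n
    by (auto simp: taylor_log_def P cluster_cumulant_def offspring_op_def add_divide_distrib ring_distribs)
  have "fps_nth (fps_deriv (Abs_fps (\<lambda>n. taylor z n 0))) n =
    fps_nth (fps_deriv (Abs_fps (\<lambda>n. taylor_log z n 0)) * Abs_fps (\<lambda>n. taylor z n 0)) n"
    by (simp only: taylor_ode)
  then have "of_nat (Suc n) * (\<i> ^ Suc n * of_real (fps_nth ?P (Suc n))) =
      (\<Sum>j=0..n. of_nat (Suc j) * (\<i> ^ Suc j * of_real (fps_nth ?A (Suc j))) * (\<i> ^ (n - j) * of_real (fps_nth ?P (n - j))))"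
    unfolding fps_mult_nth fps_deriv_nth fps_nth_Abs_fps Suc_eq_plus1[symmetric] P A .
  also have "\<dots> = (\<Sum>j=0..n. \<i> ^ Suc n * of_real (of_nat (Suc j) * fps_nth ?A (Suc j) * fps_nth ?P (n - j)))"
  proof (rule sum.cong[OF refl])
    fix j assume "j \<in> {0..n}"
    then have "\<i> ^ Suc n = \<i> ^ Suc j * \<i> ^ (n - j)"
      by (simp add: power_add[symmetric])
    then show "of_nat (Suc j) * (\<i> ^ Suc j * of_real (fps_nth ?A (Suc j))) * (\<i> ^ (n - j) * of_real (fps_nth ?P (n - j))) =
        \<i> ^ Suc n * of_real (of_nat (Suc j) * fps_nth ?A (Suc j) * fps_nth ?P (n - j))"
      by (simp only: of_real_mult of_real_of_nat_eq mult_ac)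
  qed
  also have "\<dots> = \<i> ^ Suc n * of_real (fps_nth (fps_deriv ?A * ?P) n)"
    by (simp only: sum_distrib_left[symmetric] of_real_sum[symmetric] fps_mult_nth fps_deriv_nth Suc_eq_plus1)
  finally have "\<i> ^ Suc n * of_real (of_nat (Suc n) * fps_nth ?P (Suc n)) =
      \<i> ^ Suc n * of_real (fps_nth (fps_deriv ?A * ?P) n)"
    by (simp only: of_real_mult of_real_of_nat_eq mult_ac)
  then have "of_nat (Suc n) * fps_nth ?P (Suc n) = fps_nth (fps_deriv ?A * ?P) n"
    unfolding mult_cancel_left of_real_eq_iff by (simp only: power_eq_0_iff) simp
  then show "fps_nth (fps_deriv ?P) n = fps_nth (fps_deriv ?A * ?P) n"
    by (simp only: fps_deriv_nth Suc_eq_plus1)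
qed

text \<open>The exponential generating function of the moments is the exponential of that of
  \<open>cluster_cumulant\<close>; its logarithm gives the first claim, its coefficients the
  second.\<close>

lemma cumulant_eq:
  assumes "1 \<le> n" shows "cumulant M (S z) n = cluster_cumulant z n"
    and "moment n z = complete_bell n (cluster_cumulant z)"
proof -
  define A where "A = Abs_fps (\<lambda>n. if n = 0 then 0 else cluster_cumulant z n / fact n)"
  define P where "P = Abs_fps (\<lambda>n. moment n z / fact n)"
  have "fps_deriv P = fps_deriv A * P" "fps_nth P 0 = 1" "fps_nth A 0 = 0"
    using moment_ode by (simp_all add: A_def P_def)
  note log = fps_exp_log_of_ode[OF this]
  have "Abs_fps (\<lambda>k. if k = 0 then 0 else (LINT \<omega>|M. S z \<omega> ^ k) / fact k) = P - 1"
    by (auto simp: fps_eq_iff P_def moment_def prob_space)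
  then have "cumulant M (S z) n = fact n * fps_nth A n"
    using log by (simp add: cumulant_def)
  then show "cumulant M (S z) n = cluster_cumulant z n"
    using assms by (simp add: A_def)
  have "moment n z = fact n * fps_nth P n" by (simp add: P_def)
  also have "\<dots> = fact n * fps_nth (fps_exp 1 oo A) n" by (simp only: log(1)[symmetric])
  finally show "moment n z = complete_bell n (cluster_cumulant z)"
    using assms by (simp add: complete_bell_eq_fps A_def)
qed

end

subsection \<open>The resolvent\<close>

context branching
begin

lemma offspring_op_diff:
  assumes "\<And>m z. integrable \<gamma> (\<lambda>y. (offspring_op \<gamma> ^^ m) g (z + y))"
    and "\<And>m z. integrable \<gamma> (\<lambda>y. (offspring_op \<gamma> ^^ m) h (z + y))"
  shows "(offspring_op \<gamma> ^^ m) (\<lambda>y. g y - h y) = (\<lambda>z. (offspring_op \<gamma> ^^ m) g z - (offspring_op \<gamma> ^^ m) h z)"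
proof (induction m)
  case (Suc m)
  have "offspring_op \<gamma> (\<lambda>z. u z - v z) = (\<lambda>z. offspring_op \<gamma> u z - offspring_op \<gamma> v z)"
    if "\<And>z. integrable \<gamma> (\<lambda>y. u (z + y))" "\<And>z. integrable \<gamma> (\<lambda>y. v (z + y))" for u v
    by (simp add: offspring_op_def fun_eq_iff that)
  from this[OF assms] show ?case
    by (simp only: funpow.simps o_apply Suc)
qed simp

lemma offspring_op_sum:
  assumes "\<And>k m z. k \<in> I \<Longrightarrow> integrable \<gamma> (\<lambda>y. (offspring_op \<gamma> ^^ m) (g k) (z + y))"
  shows "(offspring_op \<gamma> ^^ m) (\<lambda>y. \<Sum>k\<in>I. g k y) = (\<lambda>z. \<Sum>k\<in>I. (offspring_op \<gamma> ^^ m) (g k) z)"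
proof (induction m)
  case (Suc m)
  have "offspring_op \<gamma> (\<lambda>z. \<Sum>k\<in>I. u k z) = (\<lambda>z. \<Sum>k\<in>I. offspring_op \<gamma> (u k) z)"
    if "\<And>k z. k \<in> I \<Longrightarrow> integrable \<gamma> (\<lambda>y. u k (z + y))" for u
    by (simp add: offspring_op_def fun_eq_iff that)
  from this[OF assms] show ?case
    by (simp only: funpow.simps o_apply Suc)
qed simp

text \<open>The bound for one iterate gives its integrability, and integrability gives the bound for
  the next one.\<close>

lemma offspring_op_mono:
  assumes g: "g \<in> borel_measurable borel" "\<And>y. \<bar>g y\<bar> \<le> h y"
    and h: "\<And>m z. integrable \<gamma> (\<lambda>y. (offspring_op \<gamma> ^^ m) h (z + y))"
  shows "\<bar>(offspring_op \<gamma> ^^ m) g z\<bar> \<le> (offspring_op \<gamma> ^^ m) h z"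
    and "integrable \<gamma> (\<lambda>y. (offspring_op \<gamma> ^^ m) g (z + y))"
proof -
  have int: "integrable \<gamma> (\<lambda>y. (offspring_op \<gamma> ^^ m) g (z + y))"
    if [measurable]: "(offspring_op \<gamma> ^^ m) g \<in> borel_measurable borel"
      and le: "\<And>z. \<bar>(offspring_op \<gamma> ^^ m) g z\<bar> \<le> (offspring_op \<gamma> ^^ m) h z" for m z
  proof (rule Bochner_Integration.integrable_bound[OF h[of m z]])
    show "AE y in \<gamma>. norm ((offspring_op \<gamma> ^^ m) g (z + y)) \<le> norm ((offspring_op \<gamma> ^^ m) h (z + y))"
      using le by (intro AE_I2) (simp add: order_trans[OF _ abs_ge_self])
  qed measurable
  have *: "(offspring_op \<gamma> ^^ m) g \<in> borel_measurable borel \<and>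
      (\<forall>z. \<bar>(offspring_op \<gamma> ^^ m) g z\<bar> \<le> (offspring_op \<gamma> ^^ m) h z)" for m
  proof (induction m)
    case (Suc m)
    then have [measurable]: "(offspring_op \<gamma> ^^ m) g \<in> borel_measurable borel"
      and le: "\<And>z. \<bar>(offspring_op \<gamma> ^^ m) g z\<bar> \<le> (offspring_op \<gamma> ^^ m) h z" by blast+
    have "(\<lambda>z. LINT y|\<gamma>. (offspring_op \<gamma> ^^ m) g (z + y)) \<in> borel_measurable borel"
      by measurable
    moreover have "\<bar>LINT y|\<gamma>. (offspring_op \<gamma> ^^ m) g (z + y)\<bar> \<le> (LINT y|\<gamma>. (offspring_op \<gamma> ^^ m) h (z + y))" for z
      using int[of m z] h[of m z] le
      by (intro order_trans[OF integral_abs_bound] integral_mono) auto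
    ultimately show ?case by (simp add: offspring_op_def[abs_def])
  qed (use g in auto)
  then show "\<bar>(offspring_op \<gamma> ^^ m) g z\<bar> \<le> (offspring_op \<gamma> ^^ m) h z" by blast
  from * int show "integrable \<gamma> (\<lambda>y. (offspring_op \<gamma> ^^ m) g (z + y))" by blast
qed

text \<open>For \<open>g = m - \<Gamma> m\<close> with \<open>\<Gamma>\<^sup>j m \<rightarrow> 0\<close> the resolvent series telescopes.\<close>

lemma resolvent_telescope:
  assumes int: "\<And>j z. integrable \<gamma> (\<lambda>y. (offspring_op \<gamma> ^^ j) m (z + y))"
    and lim: "\<And>z. (\<lambda>j. (offspring_op \<gamma> ^^ j) m z) \<longlonglongrightarrow> 0"
    and g: "\<And>y. g y = m y - offspring_op \<gamma> m y"
  shows "resolvent_exists \<gamma> g" "resolvent \<gamma> g z = m z"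
    "resolvent \<gamma> (offspring_op \<gamma> g) z = offspring_op \<gamma> m z"
proof -
  have shift: "(offspring_op \<gamma> ^^ j) (offspring_op \<gamma> u) = (offspring_op \<gamma> ^^ Suc j) u" for j u
    by (simp add: funpow_swap1)
  have "g = (\<lambda>y. m y - offspring_op \<gamma> m y)" using g by (simp add: fun_eq_iff)
  then have it: "(offspring_op \<gamma> ^^ j) g = (\<lambda>z. (offspring_op \<gamma> ^^ j) m z - (offspring_op \<gamma> ^^ Suc j) m z)" for j
    using offspring_op_diff[of m "offspring_op \<gamma> m" j] int int[of "Suc _"] by (simp only: shift)
  have intg: "integrable \<gamma> (\<lambda>y. (offspring_op \<gamma> ^^ j) g (z + y))" for j z
    unfolding it by (intro Bochner_Integration.integrable_diff int)
  \<comment> \<open>The offset \<open>k = 1\<close> serves the resolvent of \<open>g\<close>, and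
    \<open>k = 2\<close> that of \<open>offspring_op \<gamma> g\<close>, whose term outside the
    series is already the first iterate of \<open>g\<close>.\<close>
  have sums: "(\<lambda>j. (offspring_op \<gamma> ^^ (j + k)) g z) sums (offspring_op \<gamma> ^^ k) m z" for k z
  proof -
    have "(\<lambda>j. (offspring_op \<gamma> ^^ (j + k)) m z) \<longlonglongrightarrow> 0"
      using lim[of z] by (rule LIMSEQ_ignore_initial_segment)
    from telescope_sums'[OF this] show ?thesis by (simp add: it del: funpow.simps)
  qed
  have s1: "(\<lambda>j. (offspring_op \<gamma> ^^ Suc j) g z) sums offspring_op \<gamma> m z" for z
    using sums[of 1 z] by simp
  show "resolvent_exists \<gamma> g"
    unfolding resolvent_exists_def using intg s1 sums_summable by blast
  show "resolvent \<gamma> g z = m z"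
    unfolding resolvent_def sums_unique[OF s1, symmetric] by (simp add: g)
  have "(\<lambda>j. (offspring_op \<gamma> ^^ Suc j) (offspring_op \<gamma> g) z) sums (offspring_op \<gamma> ^^ 2) m z"
    using sums[of 2 z] by (simp only: shift add_2_eq_Suc' )
  from sums_unique[OF this] show "resolvent \<gamma> (offspring_op \<gamma> g) z = offspring_op \<gamma> m z"
    using it[of 1] by (simp add: resolvent_def numeral_2_eq_2)
qed

end

section \<open>Resolvent identities for the cumulants\<close>

context cluster_moments
begin

text \<open>The iterates are squeezed by those of \<open>abs_moment\<close>, which are finite and
  vanish in the limit.\<close>

lemma moment_iterate:
  assumes "1 \<le> n"
  shows "integrable \<gamma> (\<lambda>y. (offspring_op \<gamma> ^^ j) (moment n) (z + y))"
    and "(\<lambda>j. (offspring_op \<gamma> ^^ j) (moment n) z) \<longlonglongrightarrow> 0"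
proof -
  note it = offspring_op_iterate[OF moment_measurable moment_le abs_moment_iterate(1)[OF assms]]
  show "integrable \<gamma> (\<lambda>y. (offspring_op \<gamma> ^^ j) (moment n) (z + y))" by (rule it)
  have "(\<lambda>j. ennreal \<bar>(offspring_op \<gamma> ^^ j) (moment n) z\<bar>) \<longlonglongrightarrow> 0"
    by (rule tendsto_sandwich[OF _ _ tendsto_const abs_moment_iterate(2)[OF assms, of z]])
      (auto simp: it)
  then have "(\<lambda>j. \<bar>(offspring_op \<gamma> ^^ j) (moment n) z\<bar>) \<longlonglongrightarrow> 0"
    by (simp add: ennreal_tendsto_0_iff)
  then show "(\<lambda>j. (offspring_op \<gamma> ^^ j) (moment n) z) \<longlonglongrightarrow> 0"
    by (simp add: tendsto_rabs_zero_iff)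
qed

text \<open>Almost sure equality with \<open>S z\<close> does not yield measurability, as
  \<open>M\<close> need not be complete. Where the tree is infinite, \<open>descendants\<close> is
  empty and the value is \<open>f z\<close>; finiteness is a measurable event, being extinction at
  some generation.\<close>

lemma cluster_sum_measurable:
  assumes \<xi>: "\<And>\<omega>. \<omega> \<in> space M \<Longrightarrow> \<xi> \<omega> = descendants off \<omega>"
  shows "cluster_sum \<xi> f z \<in> borel_measurable M"
proof -
  let ?g = "\<lambda>m \<omega>. generation_sum (\<lambda>_ _. 1) m (\<lambda>u. off u \<omega>) (0::'a)"
  have g [measurable]: "?g m \<in> borel_measurable M" for m
    by (rule measurable_conf_functional[OF off measurable_generation_sum]) simp
  have fin: "finite (tree (\<lambda>u. off u \<omega>)) \<longleftrightarrow> (\<exists>m. ?g m \<omega> = 0)" for \<omega>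
  proof
    assume "finite (tree (\<lambda>u. off u \<omega>))"
    from eventually_happens[OF generation_sum_eventually_0[OF this]]
    show "\<exists>m. ?g m \<omega> = 0" by simp
  qed (use finite_tree_of_generation_0 in blast)
  have eq: "cluster_sum \<xi> f z \<omega> = (if \<exists>m. ?g m \<omega> = 0 then S z \<omega> else f z)" if \<omega>: "\<omega> \<in> space M" for \<omega>
  proof (cases "finite (tree (\<lambda>u. off u \<omega>))")
    case True
    then show ?thesis
      using cluster_sum_descendants[of off \<omega> \<xi>] \<xi>[OF \<omega>] fin[of \<omega>] by (simp add: S_def)
  next
    case False
    then have "infinite (family_tree off \<omega>)"
      by (simp add: family_tree_def)
    then show ?thesis
      using False \<xi>[OF \<omega>] fin[of \<omega>] by (simp add: cluster_sum_def descendants_def)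
  qed
  have "(\<lambda>\<omega>. if \<exists>m. ?g m \<omega> = 0 then S z \<omega> else f z) \<in> borel_measurable M"
    by measurable
  then show ?thesis
    by (rule measurable_cong[THEN iffD2, rotated]) (rule eq)
qed

lemma cluster_cumulant_measurable: "(\<lambda>z. cluster_cumulant z n) \<in> borel_measurable borel"
  unfolding cluster_cumulant_def offspring_op_def by measurable

text \<open>The first Bell polynomial is the identity; this exhibits \<open>f\<close> in the
  telescoping form.\<close>

lemma cluster_cumulant_first: "cluster_cumulant z 1 = moment 1 z"
  using cumulant_eq(2)[of 1 z] by (simp add: complete_bell_def partial_bell_one)

lemma resolvent_first:
  "resolvent_exists \<gamma> f" "resolvent \<gamma> f z = cluster_cumulant z 1"
proof -
  have f: "f y = moment 1 y - offspring_op \<gamma> (moment 1) y" for y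
    using cluster_cumulant_first[of y] by (simp add: cluster_cumulant_def)
  note resolvent_telescope[OF moment_iterate[OF order_refl] f]
  then show "resolvent_exists \<gamma> f" "resolvent \<gamma> f z = cluster_cumulant z 1"
    by (simp_all only: cluster_cumulant_first)
qed

lemma resolvent_higher:
  assumes "2 \<le> n"
  defines "g \<equiv> \<lambda>y. complete_bell n (cluster_cumulant y) - cluster_cumulant y n"
  shows "resolvent_exists \<gamma> g" "resolvent \<gamma> (offspring_op \<gamma> g) z = cluster_cumulant z n"
proof -
  have n: "1 \<le> n" using assms by simp
  have g: "g y = moment n y - offspring_op \<gamma> (moment n) y" for y
    using assms cumulant_eq(2)[OF n, of y] by (simp add: cluster_cumulant_def)
  note tele = resolvent_telescope[OF moment_iterate[OF n] g]
  show "resolvent_exists \<gamma> g" by (rule tele)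
  show "resolvent \<gamma> (offspring_op \<gamma> g) z = cluster_cumulant z n"
    using tele(3)[of z] assms(1) by (simp add: cluster_cumulant_def)
qed

lemma cluster_moments_abs: "cluster_moments M \<gamma> off (\<lambda>y. \<bar>f y\<bar>)"
  by unfold_locales (use off moments_finite in auto)

text \<open>The cumulants for the absolute value of \<open>f\<close> are nonnegative and dominate
  those for \<open>f\<close>. So a single partial Bell term is at most the whole sum of such terms
  for the absolute value, whose series converges by telescoping.\<close>

lemma resolvent_partial_bell:
  assumes n: "2 \<le> n" and k: "k \<in> {2..n}"
  shows "resolvent_exists \<gamma> (\<lambda>y. partial_bell n k (cluster_cumulant y))"
proof -
  interpret A: cluster_moments M \<gamma> off "\<lambda>y. \<bar>f y\<bar>" by (rule cluster_moments_abs)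
  let ?h = "\<lambda>y. complete_bell n (A.cluster_cumulant y) - A.cluster_cumulant y n"
  let ?g = "\<lambda>y. partial_bell n k (cluster_cumulant y)"
  have ST: "A.moment i y = (LINT \<omega>|M. T y \<omega> ^ i)" for i y
    by (simp add: A.moment_def A.S_def T_def)
  have intT: "integrable M (\<lambda>\<omega>. T y \<omega> ^ i)" for i y
    using A.integrable_power[of y i] by (simp add: A.S_def T_def)
  have moment_le: "\<bar>moment i y\<bar> \<le> A.moment i y" for i y
  proof -
    have "real_abs_moment i y \<le> A.moment i y"
      unfolding real_abs_moment_def ST
    proof (rule integral_mono_AE[OF integrable_abs_power intT])
      show "AE \<omega> in M. \<bar>S y \<omega>\<bar> ^ i \<le> T y \<omega> ^ i"
        using AE_S_le_T[of y] by eventually_elim (auto intro!: power_mono)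
    qed
    then show ?thesis using moment_le_real_abs_moment[of i y] by simp
  qed
  have cluster_cumulant_le: "\<bar>cluster_cumulant y i\<bar> \<le> A.cluster_cumulant y i" if "1 \<le> i" for y i
  proof -
    have "\<bar>offspring_op \<gamma> (moment i) y\<bar> \<le> offspring_op \<gamma> (A.moment i) y"
      using offspring_op_mono(1)[OF moment_measurable moment_le A.moment_iterate(1)[OF that], of 1 y]
      by simp
    then show ?thesis
      unfolding cluster_cumulant_def A.cluster_cumulant_def by auto
  qed
  have le: "\<bar>?g y\<bar> \<le> ?h y" for y
  proof -
    have nn: "0 \<le> A.cluster_cumulant y i" if "1 \<le> i" for i
      using cluster_cumulant_le[OF that, of y] by simp
    have "\<bar>?g y\<bar> \<le> partial_bell n k (A.cluster_cumulant y)"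
      by (rule abs_partial_bell_le) (rule cluster_cumulant_le)
    also have "\<dots> \<le> (\<Sum>k = 2..n. partial_bell n k (A.cluster_cumulant y))"
      using k by (intro member_le_sum partial_bell_nonneg nn) auto
    finally show ?thesis by (simp only: complete_bell_minus[OF n])
  qed
  have h: "integrable \<gamma> (\<lambda>y. (offspring_op \<gamma> ^^ m) ?h (z + y))"
    and sum: "summable (\<lambda>m. (offspring_op \<gamma> ^^ Suc m) ?h z)" for m z
    using A.resolvent_higher(1)[OF n] unfolding resolvent_exists_def by blast+
  note mono = offspring_op_mono[OF borel_measurable_partial_bell[OF cluster_cumulant_measurable] le h]
  have "summable (\<lambda>m. (offspring_op \<gamma> ^^ Suc m) ?g z)" for z
    by (rule summable_comparison_test'[OF sum[of z], of 0]) (simp only: real_norm_def mono)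
  then show ?thesis
    unfolding resolvent_exists_def using mono(2) by blast
qed

text \<open>The series for the individual \<open>k\<close> converge, so the finite sum over
  \<open>k\<close> can be exchanged first with the iterated integrals and then with the
  series.\<close>

lemma resolvent_sum:
  assumes n: "2 \<le> n"
  shows "resolvent \<gamma> (offspring_op \<gamma> (\<lambda>y. complete_bell n (cluster_cumulant y) - cluster_cumulant y n)) z =
    (\<Sum>k = 2..n. resolvent \<gamma> (offspring_op \<gamma> (\<lambda>y. partial_bell n k (cluster_cumulant y))) z)"
proof -
  let ?g = "\<lambda>k y. partial_bell n k (cluster_cumulant y)"
  have shift: "(offspring_op \<gamma> ^^ j) (offspring_op \<gamma> u) = (offspring_op \<gamma> ^^ Suc j) u" for j u
    by (simp add: funpow_swap1)
  have int: "integrable \<gamma> (\<lambda>y. (offspring_op \<gamma> ^^ m) (?g k) (z + y))"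
    and sum: "summable (\<lambda>m. (offspring_op \<gamma> ^^ Suc m) (?g k) z)" if "k \<in> {2..n}" for k m z
    using resolvent_partial_bell[OF n that] unfolding resolvent_exists_def by blast+
  have eq: "(\<lambda>y. complete_bell n (cluster_cumulant y) - cluster_cumulant y n) = (\<lambda>y. \<Sum>k = 2..n. ?g k y)"
    using complete_bell_minus[OF n] by (simp add: fun_eq_iff)
  have lin: "(offspring_op \<gamma> ^^ m) (\<lambda>y. \<Sum>k = 2..n. ?g k y) = (\<lambda>z. \<Sum>k = 2..n. (offspring_op \<gamma> ^^ m) (?g k) z)" for m
    by (rule offspring_op_sum[OF int])
  have one: "(offspring_op \<gamma> ^^ 1) u = offspring_op \<gamma> u" for u by simp
  have sum2: "summable (\<lambda>m. (offspring_op \<gamma> ^^ Suc (Suc m)) (?g k) z)" if "k \<in> {2..n}" for k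
    using summable_Suc_iff[of "\<lambda>m. (offspring_op \<gamma> ^^ Suc m) (?g k) z"] sum[OF that, of z] by (rule iffD2)
  have "resolvent \<gamma> (offspring_op \<gamma> (\<lambda>y. complete_bell n (cluster_cumulant y) - cluster_cumulant y n)) z =
      (offspring_op \<gamma> ^^ 1) (\<lambda>y. \<Sum>k = 2..n. ?g k y) z +
      (\<Sum>m. (offspring_op \<gamma> ^^ Suc (Suc m)) (\<lambda>y. \<Sum>k = 2..n. ?g k y) z)"
    by (simp only: resolvent_def shift eq one)
  also have "\<dots> = (\<Sum>k = 2..n. (offspring_op \<gamma> ^^ 1) (?g k) z) +
      (\<Sum>m. \<Sum>k = 2..n. (offspring_op \<gamma> ^^ Suc (Suc m)) (?g k) z)"
    by (simp only: lin)
  also have "(\<Sum>m. \<Sum>k = 2..n. (offspring_op \<gamma> ^^ Suc (Suc m)) (?g k) z) =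
      (\<Sum>k = 2..n. \<Sum>m. (offspring_op \<gamma> ^^ Suc (Suc m)) (?g k) z)"
    by (rule suminf_sum[OF sum2])
  also have "(\<Sum>k = 2..n. (offspring_op \<gamma> ^^ 1) (?g k) z) + \<dots> =
      (\<Sum>k = 2..n. resolvent \<gamma> (offspring_op \<gamma> (?g k)) z)"
    by (simp only: resolvent_def shift sum.distrib one)
  finally show ?thesis .
qed

end

theorem proposition3p3:
  fixes M :: "'w measure"
    and \<gamma> :: "'a::euclidean_space measure"
    and \<xi> :: "'w \<Rightarrow> 'a multiset"
    and f :: "'a \<Rightarrow> real"
    and \<kappa> :: "'a \<Rightarrow> nat \<Rightarrow> real"
    and h :: "nat \<Rightarrow> 'a \<Rightarrow> real"
    and hp :: "nat \<Rightarrow> nat \<Rightarrow> 'a \<Rightarrow> real"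
  assumes "prob_space M"
    and "sets \<gamma> = sets borel"
    and "emeasure \<gamma> UNIV < 1"
    and "descendant_cluster M \<gamma> \<xi>"
    and "f \<in> borel_measurable borel"
    and "\<And>z n. 1 \<le> n \<Longrightarrow>
      (\<integral>\<^sup>+ \<omega>. ennreal ((\<bar>f z\<bar> + (\<Sum>x \<in># \<xi> \<omega>. \<bar>f (z + x)\<bar>)) ^ n) \<partial>M) < \<infinity>"
  defines "\<kappa> \<equiv> \<lambda>z n. cumulant M (cluster_sum \<xi> f z) n"
    and "h \<equiv> \<lambda>n y. complete_bell n (\<kappa> y) - \<kappa> y n"
    and "hp \<equiv> \<lambda>n k y. partial_bell n k (\<kappa> y)"
  shows "resolvent_exists \<gamma> f \<and>
    (\<forall>z. \<kappa> z 1 = resolvent \<gamma> f z) \<and>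
    (\<forall>n \<ge> 2.
       resolvent_exists \<gamma> (h n) \<and>
       (\<forall>k \<in> {2..n}. resolvent_exists \<gamma> (hp n k)) \<and>
       (\<forall>z. \<kappa> z n = resolvent \<gamma> (offspring_op \<gamma> (h n)) z \<and>
            resolvent \<gamma> (offspring_op \<gamma> (h n)) z =
              (\<Sum>k = 2..n. resolvent \<gamma> (offspring_op \<gamma> (hp n k)) z)))"
proof -
  interpret branching M \<gamma>
    by (intro branching.intro branching_axioms.intro assms)
  obtain off where poisson: "poisson_offspring M \<gamma> off" and desc: "\<And>\<omega>. \<omega> \<in> space M \<Longrightarrow> \<xi> \<omega> = descendants off \<omega>"
    using assms(4) unfolding descendant_cluster_def by blast
  \<comment> \<open>Stated for arbitrary \<open>g\<close>: the absolute value of \<open>f\<close>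
    transfers the moment hypothesis, \<open>f\<close> itself transfers the cumulants.\<close>
  have AE: "AE \<omega> in M. cluster_sum \<xi> g z \<omega> = total_sum g (\<lambda>u. off u \<omega>) z" for g z
    using AE_finite_tree[OF poisson] AE_space
    by eventually_elim (rule cluster_sum_descendants, auto simp: desc)
  interpret cluster_moments M \<gamma> off f
  proof unfold_locales
    fix n :: nat and z assume "1 \<le> n"
    have "AE \<omega> in M. ennreal (total_sum (\<lambda>y. \<bar>f y\<bar>) (\<lambda>u. off u \<omega>) z ^ n) =
        ennreal ((\<bar>f z\<bar> + (\<Sum>x \<in># \<xi> \<omega>. \<bar>f (z + x)\<bar>)) ^ n)"
      using AE[of "\<lambda>y. \<bar>f y\<bar>" z] by eventually_elim (simp add: cluster_sum_def)
    from nn_integral_cong_AE[OF this] assms(6)[OF \<open>1 \<le> n\<close>]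
    show "(\<integral>\<^sup>+\<omega>. ennreal (total_sum (\<lambda>y. \<bar>f y\<bar>) (\<lambda>u. off u \<omega>) z ^ n) \<partial>M) < \<infinity>" by simp
  qed (use poisson assms in auto)
  have cum: "\<kappa> z n = cluster_cumulant z n" if "1 \<le> n" for z n
  proof -
    have "AE \<omega> in M. cluster_sum \<xi> f z \<omega> = S z \<omega>"
      using AE[of f z] by (simp add: S_def)
    moreover have "S z \<in> borel_measurable M" by measurable
    moreover have "cluster_sum \<xi> f z \<in> borel_measurable M"
      by (rule cluster_sum_measurable) (rule desc)
    ultimately have "(LINT \<omega>|M. cluster_sum \<xi> f z \<omega> ^ k) = (LINT \<omega>|M. S z \<omega> ^ k)" for k
      by (intro integral_cong_AE borel_measurable_power) (auto elim: eventually_mono)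
    then have "\<kappa> z n = cumulant M (S z) n"
      by (simp add: \<kappa>_def cumulant_def cong: if_cong)
    then show ?thesis using cumulant_eq(1)[OF that] by simp
  qed
  \<comment> \<open>The two cumulant sequences are only known to agree from index 1 on, which
    suffices because the parts in a partial Bell polynomial are at least 1.\<close>
  have bell: "partial_bell n k (\<kappa> y) = partial_bell n k (cluster_cumulant y)" for n k y
    unfolding partial_bell_def
    by (intro arg_cong2[where f = times] sum.cong refl arg_cong[where f = prod_list] map_cong) (auto simp: cum)
  have hp: "hp n k = (\<lambda>y. partial_bell n k (cluster_cumulant y))" for n k
    by (simp add: hp_def bell)
  have h: "h n = (\<lambda>y. complete_bell n (cluster_cumulant y) - cluster_cumulant y n)" if "2 \<le> n" for n
    using that by (simp add: h_def complete_bell_def bell cum)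
  show ?thesis
    using resolvent_first resolvent_higher resolvent_partial_bell resolvent_sum
    by (simp add: cum hp h)
qed

end
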